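(* Let $G=(V,E)$ be a graph embedded in a closed orientable surface $S$ of genus $g$ so that all faces are discs, with a reference orientation. Let $h$ be a non-zero smooth circulation on $G$ and let $G'$ be the subgraph of $G$ on which $h$ does not vanish (the edges $e$ with $h_e\neq0$ together with their endpoints). Suppose that $h$ vanishes on all edges incident with a connected subgraph $U$ of $G$. Then $U$ can be separated from $G'$ by at most $16g$ nodes, i.e., there is a set $X$ of at most $16g$ nodes such that every path in $G$ from a node of $U$ to a node of $G'$ contains a node of $X$.
   Context: Each edge $e$ has tail $t(e)$, head $h(e)$, right shore $r(e)$ and left shore $l(e)$ (faces). For a node $v$, $\delta v\in\mathbb R^E$ has entries $1$ on edges with head $v$, $-1$ on edges with tail $v$, $0$ otherwise; for a face $F$, $\partial F\in\mathbb R^E$ has entries $1$ on edges with $r(e)=F$, $-1$ on edges with $l(e)=F$, $0$ otherwise. A smooth circulation is a vector $h\in\mathbb R^E$ with $h\cdot\delta v=0$ for every node $v$ and $h\cdot\partial F=0$ for every face $F$. *)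

theory Defs
  imports Complex_Main
begin

text \<open>Cellularly embedded graphs on closed orientable surfaces are represented
combinatorially by rotation systems (Heffter--Edmonds).  Edges form a finite set E
(of type 'e); each edge e carries a reference orientation and two darts:
(e,True) leaving the tail t(e) and (e,False) leaving the head h(e).
A permutation sigma of the darts gives the cyclic (counterclockwise) order of
darts around each node; nodes are the orbits of sigma, faces are the orbits of
the face permutation sigma o rev_dart.\<close>

definition orb :: "('a \<Rightarrow> 'a) \<Rightarrow> 'a \<Rightarrow> 'a set" where
  "orb f x = {(f ^^ n) x | n. True}"

definition rev_dart :: "'e \<times> bool \<Rightarrow> 'e \<times> bool" where
  "rev_dart d = (fst d, \<not> snd d)"

definition darts :: "'e set \<Rightarrow> ('e \<times> bool) set" where
  "darts E = E \<times> UNIV"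

definition rotation_system :: "'e set \<Rightarrow> ('e \<times> bool \<Rightarrow> 'e \<times> bool) \<Rightarrow> bool" where
  "rotation_system E \<sigma> \<longleftrightarrow> finite E \<and> bij_betw \<sigma> (darts E) (darts E)"

definition nodes :: "'e set \<Rightarrow> ('e \<times> bool \<Rightarrow> 'e \<times> bool) \<Rightarrow> ('e \<times> bool) set set" where
  "nodes E \<sigma> = orb \<sigma> ` darts E"

definition tl_node :: "('e \<times> bool \<Rightarrow> 'e \<times> bool) \<Rightarrow> 'e \<Rightarrow> ('e \<times> bool) set" where
  "tl_node \<sigma> e = orb \<sigma> (e, True)"

definition hd_node :: "('e \<times> bool \<Rightarrow> 'e \<times> bool) \<Rightarrow> 'e \<Rightarrow> ('e \<times> bool) set" where
  "hd_node \<sigma> e = orb \<sigma> (e, False)"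

definition faces :: "'e set \<Rightarrow> ('e \<times> bool \<Rightarrow> 'e \<times> bool) \<Rightarrow> ('e \<times> bool) set set" where
  "faces E \<sigma> = orb (\<sigma> \<circ> rev_dart) ` darts E"

text \<open>The face traced by the dart (e,True) lies to the right of e.\<close>
definition rshore :: "('e \<times> bool \<Rightarrow> 'e \<times> bool) \<Rightarrow> 'e \<Rightarrow> ('e \<times> bool) set" where
  "rshore \<sigma> e = orb (\<sigma> \<circ> rev_dart) (e, True)"

definition lshore :: "('e \<times> bool \<Rightarrow> 'e \<times> bool) \<Rightarrow> 'e \<Rightarrow> ('e \<times> bool) set" where
  "lshore \<sigma> e = orb (\<sigma> \<circ> rev_dart) (e, False)"

definition delta_node :: "('e \<times> bool \<Rightarrow> 'e \<times> bool) \<Rightarrow> ('e \<times> bool) set \<Rightarrow> 'e \<Rightarrow> real" where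
  "delta_node \<sigma> v e = (if hd_node \<sigma> e = v then 1 else 0) - (if tl_node \<sigma> e = v then 1 else 0)"

definition bd_face :: "('e \<times> bool \<Rightarrow> 'e \<times> bool) \<Rightarrow> ('e \<times> bool) set \<Rightarrow> 'e \<Rightarrow> real" where
  "bd_face \<sigma> F e = (if rshore \<sigma> e = F then 1 else 0) - (if lshore \<sigma> e = F then 1 else 0)"

definition smooth_circulation :: "'e set \<Rightarrow> ('e \<times> bool \<Rightarrow> 'e \<times> bool) \<Rightarrow> ('e \<Rightarrow> real) \<Rightarrow> bool" where
  "smooth_circulation E \<sigma> h \<longleftrightarrow>
     (\<forall>v \<in> nodes E \<sigma>. (\<Sum>e\<in>E. h e * delta_node \<sigma> v e) = 0) \<and>
     (\<forall>F \<in> faces E \<sigma>. (\<Sum>e\<in>E. h e * bd_face \<sigma> F e) = 0)"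

definition adjacent :: "'e set \<Rightarrow> ('e \<times> bool \<Rightarrow> 'e \<times> bool) \<Rightarrow> ('e \<times> bool) set \<Rightarrow> ('e \<times> bool) set \<Rightarrow> bool" where
  "adjacent E \<sigma> u w \<longleftrightarrow> (\<exists>e\<in>E. (tl_node \<sigma> e = u \<and> hd_node \<sigma> e = w) \<or> (tl_node \<sigma> e = w \<and> hd_node \<sigma> e = u))"

definition is_path :: "'e set \<Rightarrow> ('e \<times> bool \<Rightarrow> 'e \<times> bool) \<Rightarrow> ('e \<times> bool) set list \<Rightarrow> bool" where
  "is_path E \<sigma> p \<longleftrightarrow> p \<noteq> [] \<and> set p \<subseteq> nodes E \<sigma> \<and> distinct p \<and>
     (\<forall>i. Suc i < length p \<longrightarrow> adjacent E \<sigma> (p ! i) (p ! Suc i))"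

definition connected_nodes :: "'e set \<Rightarrow> ('e \<times> bool \<Rightarrow> 'e \<times> bool) \<Rightarrow> ('e \<times> bool) set set \<Rightarrow> bool" where
  "connected_nodes E \<sigma> S \<longleftrightarrow> S \<noteq> {} \<and> S \<subseteq> nodes E \<sigma> \<and>
     (\<forall>u\<in>S. \<forall>w\<in>S. \<exists>p. is_path E \<sigma> p \<and> hd p = u \<and> last p = w \<and> set p \<subseteq> S)"

definition has_genus :: "'e set \<Rightarrow> ('e \<times> bool \<Rightarrow> 'e \<times> bool) \<Rightarrow> nat \<Rightarrow> bool" where
  "has_genus E \<sigma> g \<longleftrightarrow>
     int (card (nodes E \<sigma>)) - int (card E) + int (card (faces E \<sigma>)) = 2 - 2 * int g"

definition support_nodes :: "'e set \<Rightarrow> ('e \<times> bool \<Rightarrow> 'e \<times> bool) \<Rightarrow> ('e \<Rightarrow> real) \<Rightarrow> ('e \<times> bool) set set" where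
  "support_nodes E \<sigma> h = {v. \<exists>e\<in>E. h e \<noteq> 0 \<and> (v = tl_node \<sigma> e \<or> v = hd_node \<sigma> e)}"

end

(* Removing an edge on which h vanishes, by deletion or by contraction, multiplies the node and face
permutations by transpositions, and each transposition destroys at most one orbit on which h sums to
zero.  Hence |E| minus the number of such orbits never exceeds its initial value 2g - 2, even when a
removal lowers the genus.  Let Y be the set of nodes of G' adjacent to the component W of U in
G - V(G').  Contract W to a single node, contract every other zero node into a neighbour, and delete
all zero edges except one from W to each node of Y.  Then choose signs: the sign of h on the support,
alternating signs around W.  Every corner is a sign change for exactly one of its node and its face.
Each zero-sum orbit other than W meets the support, so it has at least two sign changes, while W has
at least card Y - 1.  This gives card Y <= 4g - 1. *)

theory Submission
  imports Defs "HOL-Combinatorics.Transposition"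
begin

subsection \<open>Orbits of a permutation of a finite set\<close>

text \<open>The obstacle to a plain count with Euler's formula is that deleting a zero edge with the
  same face on both sides splits that face, possibly into two parts where \<open>h\<close> has
  non-zero sums, so \<open>h\<close> need not stay a smooth circulation. Counting only zero-sum
  orbits absorbs this, and these are just the orbits forced to show both signs once they meet the
  support. Deletion and contraction are one operation, since passing from the node permutation
  \<open>f\<close> to \<open>f \<circ> rv\<close> and back is surface duality; the argument
  therefore runs on abstract darts and permutations. A single edge per node of Y is kept so that a
  face passing along it meets the support at once; otherwise the free choice of signs around W could
  leave faces without sign changes. As there are 2|E| corners and V + F = |E| + 2 - 2g, the excess
  card Y - 3 of W over the usual two sign changes is at most 4g - 4.\<close>

definition orbs :: "('a \<Rightarrow> 'a) \<Rightarrow> 'a set \<Rightarrow> 'a set set" where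
  "orbs f D = orb f ` D"

lemma orb_self: "x \<in> orb f x"
  unfolding orb_def by (auto intro: exI[of _ 0])

lemma orb_step: "y \<in> orb f x \<Longrightarrow> f y \<in> orb f x"
  unfolding orb_def by (auto intro: exI[of _ "Suc _"])

lemma orb_least:
  assumes "x \<in> T" and "\<And>y. y \<in> T \<Longrightarrow> f y \<in> T"
  shows "orb f x \<subseteq> T"
proof -
  have "(f ^^ n) x \<in> T" for n
    by (induction n) (use assms in auto)
  then show ?thesis by (auto simp: orb_def)
qed

lemma orb_mono: "y \<in> orb f x \<Longrightarrow> orb f y \<subseteq> orb f x"
  by (rule orb_least) (auto intro: orb_step)

lemma bij_mem: "bij_betw f D D \<Longrightarrow> x \<in> D \<Longrightarrow> f x \<in> D"
  by (auto simp: bij_betw_def)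

lemma orb_subset: "bij_betw f D D \<Longrightarrow> x \<in> D \<Longrightarrow> orb f x \<subseteq> D"
  by (rule orb_least) (auto intro: bij_mem)

text \<open>Forward iterates suffice for symmetry: an injective map of the finite orbit of
  \<open>x\<close> into itself is onto, so \<open>x\<close> has a predecessor there and is reached
  again from \<open>f x\<close>.\<close>

lemma orb_sym:
  assumes fin: "finite D" and bij: "bij_betw f D D" and x: "x \<in> D" and y: "y \<in> orb f x"
  shows "x \<in> orb f y"
proof -
  have closed: "x \<in> orb f (f x)" if x: "x \<in> D" for x
  proof -
    have sub: "orb f x \<subseteq> D" using orb_subset[OF bij x] .
    have "inj_on f (orb f x)" using bij sub by (meson bij_betw_def inj_on_subset)
    moreover have "f ` orb f x \<subseteq> orb f x" by (auto intro: orb_step)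
    moreover have "finite (orb f x)" using sub fin finite_subset by blast
    ultimately have "f ` orb f x = orb f x" by (meson endo_inj_surj)
    then obtain z where z: "z \<in> orb f x" "f z = x" using orb_self[of x f] by (metis imageE)
    have "orb f x \<subseteq> insert x (orb f (f x))"
      by (rule orb_least) (auto intro: orb_step orb_self)
    then show ?thesis using z by (cases "z = x") (auto intro: orb_self dest: orb_step)
  qed
  have "orb f x \<subseteq> {z \<in> D. x \<in> orb f z}"
  proof (rule orb_least)
    fix z assume "z \<in> {z \<in> D. x \<in> orb f z}"
    then show "f z \<in> {z \<in> D. x \<in> orb f z}"
      using bij_mem[OF bij] closed[of z] orb_mono[of z f "f z"] by blast
  qed (use x orb_self[of x f] in auto)
  then show ?thesis using y by auto
qed

lemma orb_eq:
  assumes "finite D" "bij_betw f D D" "x \<in> D" "y \<in> orb f x"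
  shows "orb f y = orb f x"
  using orb_mono[OF assms(4)] orb_mono[OF orb_sym[OF assms]] by blast

lemma orb_disjoint:
  assumes "finite D" "bij_betw f D D" "x \<in> D" "y \<in> D" "orb f x \<noteq> orb f y"
  shows "orb f x \<inter> orb f y = {}"
  using orb_eq[OF assms(1,2)] assms(3-5) by blast

lemma orbs_disjoint:
  assumes "finite D" "bij_betw f D D" "A \<in> orbs f D" "B \<in> orbs f D" "A \<noteq> B"
  shows "A \<inter> B = {}"
  using assms orb_disjoint[OF assms(1,2)] unfolding orbs_def by blast

lemma orbs_eq_orb:
  assumes "finite D" "bij_betw f D D" "A \<in> orbs f D" "x \<in> A"
  shows "A = orb f x" "x \<in> D"
  using assms orb_eq[OF assms(1,2)] orb_subset[OF assms(2)] unfolding orbs_def by blast+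

lemma orb_cong:
  assumes "\<And>y. y \<in> orb f x \<Longrightarrow> g y = f y"
  shows "orb g x = orb f x"
proof -
  have "(g ^^ n) x = (f ^^ n) x" for n
  proof (induction n)
    case (Suc n)
    have "(f ^^ n) x \<in> orb f x" by (auto simp: orb_def)
    then show ?case using Suc assms by simp
  qed simp
  then show ?thesis by (simp add: orb_def)
qed

lemma orbs_cong:
  assumes "bij_betw f D D" "\<And>y. y \<in> D \<Longrightarrow> g y = f y"
  shows "orbs g D = orbs f D"
  unfolding orbs_def using orb_subset[OF assms(1)] assms(2)
  by (intro image_cong orb_cong) auto

lemma finite_orbs: "finite D \<Longrightarrow> finite (orbs f D)"
  by (simp add: orbs_def)

lemma Union_orbs: "bij_betw f D D \<Longrightarrow> \<Union>(orbs f D) = D"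
  using orb_subset[of f D] orb_self[of _ f] unfolding orbs_def by blast

lemma sum_orbs:
  assumes "finite D" "bij_betw f D D"
  shows "sum g D = (\<Sum>A\<in>orbs f D. sum g A)"
proof -
  have "sum g (\<Union>(orbs f D)) = (\<Sum>A\<in>orbs f D. sum g A)"
  proof (subst sum.Union_disjoint)
    show "\<forall>A\<in>orbs f D. finite A"
      using assms(1) Union_orbs[OF assms(2)] by (metis Union_upper finite_subset)
    show "\<forall>A\<in>orbs f D. \<forall>B\<in>orbs f D. A \<noteq> B \<longrightarrow> A \<inter> B = {}"
      using orbs_disjoint[OF assms] by simp
  qed simp
  then show ?thesis by (simp add: Union_orbs[OF assms(2)])
qed

subsection \<open>Multiplication by a transposition\<close>

lemma bij_betw_transpose_comp:
  assumes "bij_betw f D D" "a \<in> D" "b \<in> D"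
  shows "bij_betw (transpose a b \<circ> f) D D"
proof (rule bij_betw_trans[OF assms(1)])
  show "bij_betw (transpose a b) D D"
    using assms(2,3) by (simp add: bij_betw_def)
qed

text \<open>The predecessor of \<open>a\<close> is redirected to \<open>b\<close> and that of
  \<open>b\<close> to \<open>a\<close>, so each of the two cycles, instead of closing, runs on into
  the other.\<close>

lemma orb_transpose_merge:
  assumes fin: "finite D" and bij: "bij_betw f D D" and a: "a \<in> D" and b: "b \<in> D"
    and ne: "orb f a \<noteq> orb f b"
  shows "orb (transpose a b \<circ> f) a = orb f a \<union> orb f b"
proof -
  define g where "g = transpose a b \<circ> f"
  have disj: "orb f a \<inter> orb f b = {}" by (rule orb_disjoint[OF fin bij a b ne])
  have ab: "a \<notin> orb f b" "b \<notin> orb f a" using disj orb_self[of a f] orb_self[of b f] by blast+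
  \<comment> \<open>Stated for arbitrary \<open>c\<close> and \<open>d\<close> so that it serves
    both cycles: from \<open>c\<close> on, \<open>g\<close> and \<open>f\<close> agree until the
    predecessor of \<open>c\<close>, which \<open>g\<close> sends to \<open>d\<close>.\<close>
  have half: "orb f c \<subseteq> orb g c" "d \<in> orb g c"
    if c: "c \<in> D" and cd: "d \<notin> orb f c" and g: "g = transpose c d \<circ> f" for c d
  proof -
    have "orb f c \<subseteq> orb g c \<inter> orb f c"
    proof (rule orb_least)
      fix y assume y: "y \<in> orb g c \<inter> orb f c"
      have fy: "f y \<in> orb f c" using y orb_step[of y f c] by blast
      then have "f y \<noteq> d" using cd by blast
      moreover have "f y \<noteq> c \<Longrightarrow> f y \<noteq> d \<Longrightarrow> g y = f y" by (simp add: g)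
      ultimately have "f y \<in> orb g c"
        using y orb_self[of c g] orb_step[of y g c] by (cases "f y = c") auto
      then show "f y \<in> orb g c \<inter> orb f c" using fy by blast
    qed (simp add: orb_self)
    then show sub: "orb f c \<subseteq> orb g c" by blast
    obtain z where z: "z \<in> D" "f z = c" using bij c by (metis bij_betw_def imageE)
    have "z \<in> orb f c"
      using orb_sym[OF fin bij z(1), of c] orb_step[OF orb_self[of z f]] unfolding z(2) by simp
    then have "z \<in> orb g c" using sub by blast
    then show "d \<in> orb g c" using orb_step[of z g c] z(2) by (simp add: g)
  qed
  have g: "g = transpose a b \<circ> f" "g = transpose b a \<circ> f"
    by (simp_all add: g_def transpose_commute)
  have "orb f b \<subseteq> orb g a"
    using half(1)[OF b ab(1) g(2)] orb_mono[OF half(2)[OF a ab(2) g(1)]] by blast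
  then have "orb f a \<union> orb f b \<subseteq> orb g a" using half(1)[OF a ab(2) g(1)] by blast
  moreover have "orb g a \<subseteq> orb f a \<union> orb f b"
  proof (rule orb_least)
    fix y assume "y \<in> orb f a \<union> orb f b"
    then show "g y \<in> orb f a \<union> orb f b"
      using orb_step[of y f] orb_self[of a f] orb_self[of b f]
      by (auto simp: g_def transpose_def)
  qed (simp add: orb_self)
  ultimately show ?thesis unfolding g_def by blast
qed

lemma orb_transpose_other:
  assumes "a \<notin> orb f x" "b \<notin> orb f x"
  shows "orb (transpose a b \<circ> f) x = orb f x"
proof (rule orb_cong)
  fix y assume "y \<in> orb f x"
  then have "f y \<noteq> a" "f y \<noteq> b" using orb_step[of y f x] assms by blast+
  then show "(transpose a b \<circ> f) y = f y" by simp
qed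

lemma orbs_transpose_merge:
  assumes fin: "finite D" and bij: "bij_betw f D D" and a: "a \<in> D" and b: "b \<in> D"
    and ne: "orb f a \<noteq> orb f b"
  shows "orbs (transpose a b \<circ> f) D = insert (orb f a \<union> orb f b) (orbs f D - {orb f a, orb f b})"
proof -
  let ?g = "transpose a b \<circ> f"
  have bij': "bij_betw ?g D D" by (rule bij_betw_transpose_comp[OF bij a b])
  note mrg = orb_transpose_merge[OF fin bij a b ne]
  have merged: "orb ?g x = (if x \<in> orb f a \<union> orb f b then orb f a \<union> orb f b else orb f x)"
    if x: "x \<in> D" for x
  proof (cases "x \<in> orb f a \<union> orb f b")
    case True
    then show ?thesis using orb_eq[OF fin bij' a] mrg by simp
  next
    case False
    then have "a \<notin> orb f x" "b \<notin> orb f x" using orb_sym[OF fin bij x] by blast+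
    then show ?thesis using False orb_transpose_other[of a f x b] by simp
  qed
  have mem_iff: "x \<in> orb f a \<union> orb f b \<longleftrightarrow> orb f x \<in> {orb f a, orb f b}" if "x \<in> D" for x
    using orb_eq[OF fin bij] a b orb_self[of x f] by blast
  show ?thesis
    unfolding orbs_def
  proof (intro equalityI subsetI)
    fix A assume "A \<in> orb ?g ` D"
    then show "A \<in> insert (orb f a \<union> orb f b) (orb f ` D - {orb f a, orb f b})"
      using merged mem_iff by (auto split: if_splits)
  next
    fix A assume "A \<in> insert (orb f a \<union> orb f b) (orb f ` D - {orb f a, orb f b})"
    then consider "A = orb f a \<union> orb f b" | x where "x \<in> D" "A = orb f x" "A \<notin> {orb f a, orb f b}"
      by auto
    then show "A \<in> orb ?g ` D"
    proof cases
      case 1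
      then show ?thesis using mrg a by auto
    next
      case (2 x)
      then show ?thesis using 2 merged[of x] mem_iff[of x] by auto
    qed
  qed
qed

text \<open>With \<open>n\<close> the first time at which \<open>f\<close> leads from
  \<open>a\<close> to \<open>b\<close>, the new orbit of \<open>a\<close> stays in the segment
  before time \<open>n\<close>: the step into \<open>b\<close> is bent back to
  \<open>a\<close>.\<close>

lemma orb_transpose_split:
  assumes ab: "a \<noteq> b" and b: "b \<in> orb f a"
  shows "b \<notin> orb (transpose a b \<circ> f) a"
proof -
  define n where "n = (LEAST n. (f ^^ n) a = b)"
  have ex: "\<exists>n. (f ^^ n) a = b" using b by (auto simp: orb_def)
  have n: "(f ^^ n) a = b" unfolding n_def by (rule LeastI_ex[OF ex])
  have least: "(f ^^ i) a \<noteq> b" if "i < n" for i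
    using not_less_Least that unfolding n_def by blast
  have n0: "n > 0" using n ab by (cases n) auto
  define T where "T = (\<lambda>i. (f ^^ i) a) ` {..<n}"
  have "orb (transpose a b \<circ> f) a \<subseteq> T"
  proof (rule orb_least)
    show aT: "a \<in> T" using n0 by (auto simp: T_def intro: image_eqI[of _ _ 0])
    fix y assume "y \<in> T"
    then obtain i where i: "i < n" "y = (f ^^ i) a" by (auto simp: T_def)
    have fy: "f y = (f ^^ Suc i) a" using i by simp
    show "(transpose a b \<circ> f) y \<in> T"
    proof (cases "Suc i = n")
      case True
      then show ?thesis using n aT fy by auto
    next
      case False
      then have lt: "Suc i < n" using i by simp
      have "f y \<noteq> b" using least[OF lt] fy by simp
      \<comment> \<open>A return to \<open>a\<close> at time \<open>Suc i\<close> would let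
        \<open>b\<close> be reached already at time \<open>n - Suc i\<close>.\<close>
      moreover have "f y \<noteq> a"
      proof
        assume fa: "f y = a"
        have "(f ^^ (n - Suc i + Suc i)) a = (f ^^ (n - Suc i)) ((f ^^ Suc i) a)"
          unfolding funpow_add by simp
        also have "\<dots> = (f ^^ (n - Suc i)) a" using fa fy by simp
        finally have "(f ^^ (n - Suc i)) a = b" using n lt by simp
        then show False using least[of "n - Suc i"] lt by simp
      qed
      ultimately have "(transpose a b \<circ> f) y = f y" by simp
      then show ?thesis using fy lt unfolding T_def by (metis imageI lessThan_iff)
    qed
  qed
  then show ?thesis using least by (auto simp: T_def)
qed

subsection \<open>Skipping an element\<close>

text \<open>The first-return map to the complement of \<open>d\<close>: the cycle notation of
  \<open>f\<close> with \<open>d\<close> struck out. The condition \<open>f d \<noteq> d\<close> in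
  the lemmas below ensures that no orbit disappears.\<close>

definition skip :: "('a \<Rightarrow> 'a) \<Rightarrow> 'a \<Rightarrow> 'a \<Rightarrow> 'a" where
  "skip f d x = (if f x = d then f d else f x)"

lemma bij_betw_skip:
  assumes fin: "finite D" and bij: "bij_betw f D D" and d: "d \<in> D" and ne: "f d \<noteq> d"
  shows "bij_betw (skip f d) (D - {d}) (D - {d})"
proof -
  have inj: "inj_on f D" using bij by (simp add: bij_betw_def)
  have "inj_on (skip f d) (D - {d})"
    using inj d by (auto simp: inj_on_def skip_def split: if_splits)
  moreover have "skip f d ` (D - {d}) \<subseteq> D - {d}"
    using bij_mem[OF bij] d ne by (auto simp: skip_def)
  ultimately show ?thesis using fin by (simp add: bij_betw_def endo_inj_surj)
qed

lemma orb_skip: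
  assumes fin: "finite D" and bij: "bij_betw f D D" and d: "d \<in> D" and ne: "f d \<noteq> d"
    and x: "x \<in> D - {d}"
  shows "orb (skip f d) x = orb f x - {d}"
proof
  show "orb (skip f d) x \<subseteq> orb f x - {d}"
  proof (rule orb_least)
    fix y assume "y \<in> orb f x - {d}"
    then show "skip f d y \<in> orb f x - {d}"
      using orb_step[of y f x] orb_step[of d f x] ne by (auto simp: skip_def)
  qed (use x orb_self[of x f] in auto)
  let ?C = "orb (skip f d) x"
  \<comment> \<open>The second set is \<open>{d}\<close> or empty: \<open>d\<close> is adjoined
    exactly if its successor lies in \<open>?C\<close>, which makes the union closed under
    \<open>f\<close>.\<close>
  have "orb f x \<subseteq> ?C \<union> {z. z = d \<and> f d \<in> ?C}"
  proof (rule orb_least)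
    fix y assume "y \<in> ?C \<union> {z. z = d \<and> f d \<in> ?C}"
    then show "f y \<in> ?C \<union> {z. z = d \<and> f d \<in> ?C}"
      using orb_step[of y "skip f d" x] by (auto simp: skip_def split: if_splits)
  qed (simp add: orb_self)
  then show "orb f x - {d} \<subseteq> ?C" by blast
qed

lemma orbs_skip:
  assumes fin: "finite D" and bij: "bij_betw f D D" and d: "d \<in> D" and ne: "f d \<noteq> d"
  shows "orbs (skip f d) (D - {d}) = (\<lambda>A. A - {d}) ` orbs f D"
proof -
  have "orb f (f d) = orb f d" by (rule orb_eq[OF fin bij d orb_step[OF orb_self]])
  moreover have "f d \<in> D - {d}" using bij_mem[OF bij d] ne by simp
  ultimately have "orb f d \<in> orb f ` (D - {d})" by (metis imageI)
  moreover have "orb f ` D = insert (orb f d) (orb f ` (D - {d}))" using d by blast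
  ultimately have eq: "orb f ` D = orb f ` (D - {d})" by (simp add: insert_absorb)
  show ?thesis
    unfolding orbs_def eq image_image by (rule image_cong[OF refl orb_skip[OF fin bij d ne]])
qed

subsection \<open>Balanced orbits\<close>

text \<open>For a smooth circulation, written as a weight on darts, these are all nodes or all
  faces; after edges have been removed they take the place of nodes and faces in the Euler
  count.\<close>

definition balanced :: "('a \<Rightarrow> real) \<Rightarrow> ('a \<Rightarrow> 'a) \<Rightarrow> 'a set \<Rightarrow> 'a set set" where
  "balanced H f D = {A \<in> orbs f D. sum H A = 0}"

text \<open>Two zero sums add up to a zero sum, so merging two balanced orbits loses only one;
  otherwise at most one of the two was balanced. In the other direction, the merged orbit is the
  only new one.\<close>

lemma card_balanced_merge:
  assumes fin: "finite D" and bij: "bij_betw f D D" and a: "a \<in> D" and b: "b \<in> D"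
    and ne: "orb f a \<noteq> orb f b"
  shows "card (balanced H f D) \<le> Suc (card (balanced H (transpose a b \<circ> f) D))"
    and "card (balanced H (transpose a b \<circ> f) D) \<le> Suc (card (balanced H f D))"
proof -
  let ?g = "transpose a b \<circ> f" and ?A = "orb f a" and ?B = "orb f b"
  have orbs: "orbs ?g D = insert (?A \<union> ?B) (orbs f D - {?A, ?B})"
    by (rule orbs_transpose_merge[OF fin bij a b ne])
  have disj: "?A \<inter> ?B = {}" by (rule orb_disjoint[OF fin bij a b ne])
  have finAB: "finite ?A" "finite ?B"
    using orb_subset[OF bij] a b fin finite_subset by blast+
  have sum: "sum H (?A \<union> ?B) = sum H ?A + sum H ?B"
    by (rule sum.union_disjoint[OF finAB disj])
  have new: "?A \<union> ?B \<notin> orbs f D"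
  proof
    assume "?A \<union> ?B \<in> orbs f D"
    then have "?A \<union> ?B = ?A" "?A \<union> ?B = ?B"
      using orbs_eq_orb(1)[OF fin bij] orb_self[of a f] orb_self[of b f] by blast+
    then show False using ne by simp
  qed
  let ?F = "balanced H f D" and ?G = "balanced H ?g D"
  have fins: "finite ?F" "finite ?G" using finite_orbs[OF fin] by (auto simp: balanced_def)
  show "card ?F \<le> Suc (card ?G)"
  proof (cases "?A \<in> ?F \<and> ?B \<in> ?F")
    case True
    then have "insert (?A \<union> ?B) (?F - {?A, ?B}) \<subseteq> ?G"
      using sum by (auto simp: balanced_def orbs)
    then have "card (insert (?A \<union> ?B) (?F - {?A, ?B})) \<le> card ?G"
      by (rule card_mono[OF fins(2)])
    moreover have "card (insert (?A \<union> ?B) (?F - {?A, ?B})) = Suc (card ?F - 2)"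
      using True fins(1) ne new by (subst card_insert_disjoint) (auto simp: balanced_def card_Diff_subset)
    ultimately show ?thesis by simp
  next
    case False
    have "?F - {?A, ?B} \<subseteq> ?G" by (auto simp: balanced_def orbs)
    then have "?F \<subseteq> insert ?A ?G \<or> ?F \<subseteq> insert ?B ?G" using False by blast
    then obtain C where "?F \<subseteq> insert C ?G" by blast
    then have "card ?F \<le> card (insert C ?G)" using fins by (intro card_mono) auto
    also have "\<dots> \<le> Suc (card ?G)" by (rule card_insert_le_m1) simp_all
    finally show ?thesis .
  qed
  have "?G \<subseteq> insert (?A \<union> ?B) ?F" by (auto simp: balanced_def orbs)
  then have "card ?G \<le> card (insert (?A \<union> ?B) ?F)" using fins by (intro card_mono) auto
  also have "\<dots> \<le> Suc (card ?F)" by (rule card_insert_le_m1) simp_all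
  finally show "card ?G \<le> Suc (card ?F)" .
qed

text \<open>If \<open>a\<close> and \<open>b\<close> share an orbit, the transposition splits it,
  and the same transposition merges the parts again; so the loss in a split is the gain in a
  merge.\<close>

lemma card_balanced_transpose:
  assumes fin: "finite D" and bij: "bij_betw f D D" and a: "a \<in> D" and b: "b \<in> D" and ab: "a \<noteq> b"
  shows "card (balanced H f D) \<le> Suc (card (balanced H (transpose a b \<circ> f) D))"
proof (cases "orb f a = orb f b")
  case False
  then show ?thesis by (rule card_balanced_merge(1)[OF fin bij a b])
next
  case True
  let ?g = "transpose a b \<circ> f"
  have "b \<notin> orb ?g a" using orb_transpose_split[OF ab] True orb_self by metis
  then have ne: "orb ?g a \<noteq> orb ?g b" using orb_self by metis
  have "transpose a b \<circ> ?g = f" by (simp add: fun_eq_iff)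
  then show ?thesis
    using card_balanced_merge(2)[OF fin bij_betw_transpose_comp[OF bij a b] a b ne, of H] by simp
qed

text \<open>Discarding zero-weight elements keeps every sum, and non-emptiness of the trimmed sets
  keeps distinct, hence disjoint, orbits distinct.\<close>

lemma card_balanced_image:
  assumes fin: "finite D" and bij: "bij_betw f D D"
    and orbs: "orbs g D' = (\<lambda>A. A - S) ` orbs f D"
    and zero: "\<And>x. x \<in> S \<Longrightarrow> H x = 0"
    and ne: "\<And>A. A \<in> orbs f D \<Longrightarrow> A - S \<noteq> {}"
  shows "card (balanced H g D') = card (balanced H f D)"
proof -
  have sum: "sum H (A - S) = sum H A" if "A \<in> orbs f D" for A
  proof (rule sum.mono_neutral_left)
    show "finite A" using that Union_orbs[OF bij] fin by (metis Union_upper finite_subset)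
  qed (use zero in auto)
  have "{A \<in> (\<lambda>A. A - S) ` orbs f D. sum H A = 0} = (\<lambda>A. A - S) ` {A \<in> orbs f D. sum H (A - S) = 0}"
    by blast
  also have "{A \<in> orbs f D. sum H (A - S) = 0} = balanced H f D"
    using sum by (simp add: balanced_def cong: conj_cong)
  finally have "balanced H g D' = (\<lambda>A. A - S) ` balanced H f D"
    by (simp add: balanced_def[of H g] orbs)
  moreover have "inj_on (\<lambda>A. A - S) (balanced H f D)"
  proof (rule inj_onI)
    fix A B assume AB: "A \<in> balanced H f D" "B \<in> balanced H f D" "A - S = B - S"
    then have "A \<inter> B \<noteq> {}" using ne[of A] unfolding balanced_def by blast
    then show "A = B" using AB orbs_disjoint[OF fin bij, of A B] unfolding balanced_def by blast
  qed
  ultimately show ?thesis by (simp add: card_image)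
qed

subsection \<open>Removing an edge\<close>

text \<open>Only reversal and weights are fixed; the dart set and the permutation stay variable
  because the inductions change both. \<open>H x\<close> is the signed flow along the dart
  \<open>x\<close>.\<close>

locale weighted_darts =
  fixes rv :: "'d \<Rightarrow> 'd" and H :: "'d \<Rightarrow> real"
  assumes rv_rv [simp]: "rv (rv x) = x"
    and rv_neq [simp]: "rv x \<noteq> x"
    and H_rv [simp]: "H (rv x) = - H x"
begin

lemma rv_eq_iff [simp]: "rv x = rv y \<longleftrightarrow> x = y"
  by (metis rv_rv)

lemma bij_betw_rv: "rv ` D \<subseteq> D \<Longrightarrow> bij_betw rv D D"
  by (rule bij_betw_byWitness[where f' = rv]) auto

lemma bij_betw_comp_rv: "bij_betw f D D \<Longrightarrow> rv ` D \<subseteq> D \<Longrightarrow> bij_betw (f \<circ> rv) D D"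
  by (rule bij_betw_trans[OF bij_betw_rv])

text \<open>For a node permutation f this is the deletion of an edge; for a face permutation f, where
f composed with rv is the node permutation, it is the contraction of an edge, and the last
conclusion then describes the nodes.\<close>

lemma remove_edge:
  assumes fin: "finite D" and bij: "bij_betw f D D" and rvD: "rv ` D \<subseteq> D"
    and d: "d \<in> D" and Hd: "H d = 0"
    and ne1: "\<not> orb f d \<subseteq> {d, rv d}" and ne2: "\<not> orb f (rv d) \<subseteq> {d, rv d}"
  obtains g where
    "bij_betw g (D - {d, rv d}) (D - {d, rv d})"
    "orbs g (D - {d, rv d}) = (\<lambda>A. A - {d, rv d}) ` orbs f D"
    "card (balanced H (f \<circ> rv) D) \<le> Suc (card (balanced H (g \<circ> rv) (D - {d, rv d})))"
    "orb (f \<circ> rv) d \<noteq> orb (f \<circ> rv) (rv d) \<Longrightarrow>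
      orbs (g \<circ> rv) (D - {d, rv d}) =
        insert (orb (f \<circ> rv) d \<union> orb (f \<circ> rv) (rv d) - {d, rv d})
          (orbs (f \<circ> rv) D - {orb (f \<circ> rv) d, orb (f \<circ> rv) (rv d)})"
proof -
  define e where "e = rv d"
  define s where "s = skip f d"
  define g where "g = skip s e"
  define p where "p = f \<circ> rv"
  \<comment> \<open>Apart from dropping \<open>d\<close> and \<open>e\<close>, all change of orbits
    sits in this one transposition: \<open>p1\<close> agrees with \<open>s \<circ> rv\<close> on the
    darts other than \<open>e\<close>, sends \<open>e\<close> to \<open>d\<close>, and becomes
    \<open>g \<circ> rv\<close> once \<open>d\<close> and \<open>e\<close> are struck out.\<close>
  define p1 where "p1 = transpose d (f d) \<circ> p"
  define k where "k = skip (skip p1 d) e"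
  let ?D = "D - {d, e}"
  have e: "e \<in> D" "e \<noteq> d" "rv e = d" using rvD d by (auto simp: e_def)
  have inj: "inj_on f D" using bij by (simp add: bij_betw_def)
  have fd: "f d \<noteq> d"
  proof
    assume "f d = d"
    then have "orb f d \<subseteq> {d}" by (intro orb_least) auto
    then show False using ne1 by blast
  qed
  have bs: "bij_betw s (D - {d}) (D - {d})"
    unfolding s_def by (rule bij_betw_skip[OF fin bij d fd])
  have se: "s e \<noteq> e"
  proof
    assume "s e = e"
    then have "orb s e \<subseteq> {e}" by (intro orb_least) auto
    then show False using ne2 orb_skip[OF fin bij d fd, of e] e by (auto simp: s_def e_def)
  qed
  have dd: "D - {d} - {e} = ?D" by auto
  have bg: "bij_betw g ?D ?D"
    using bij_betw_skip[OF _ bs _ se] fin e by (simp add: g_def dd)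
  have og: "orbs g ?D = (\<lambda>A. A - {d, e}) ` orbs f D"
  proof -
    have "orbs g ?D = (\<lambda>A. A - {e}) ` orbs s (D - {d})"
      using orbs_skip[OF _ bs _ se] fin e by (simp add: g_def dd)
    also have "orbs s (D - {d}) = (\<lambda>A. A - {d}) ` orbs f D"
      unfolding s_def by (rule orbs_skip[OF fin bij d fd])
    finally show ?thesis by (simp add: image_image Diff_insert2[symmetric] insert_commute)
  qed
  have bp: "bij_betw p D D" unfolding p_def by (rule bij_betw_comp_rv[OF bij rvD])
  have fdD: "f d \<in> D" by (rule bij_mem[OF bij d])
  have bp1: "bij_betw p1 D D" unfolding p1_def by (rule bij_betw_transpose_comp[OF bp d fdD])
  have p1: "p1 y = s (rv y)" if "y \<in> D" "y \<noteq> e" for y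
  proof -
    have "rv y \<noteq> d" "rv y \<in> D" using that rvD by (auto simp: e_def)
    then have "f (rv y) \<noteq> f d" using inj d by (auto simp: inj_on_def)
    then show ?thesis by (auto simp: p1_def p_def s_def skip_def transpose_def)
  qed
  have p1e: "p1 e = d" by (simp add: p1_def p_def e(3))
  have p1d: "p1 d = s e" using p1[OF d e(2)[symmetric]] by (simp add: e_def)
  have sD: "s z \<in> D" "s z \<noteq> d" if "z \<in> D" "z \<noteq> d" for z
    using bij_mem[OF bs, of z] that by auto
  have p1dd: "p1 d \<noteq> d" using p1d sD[OF e(1,2)] by simp
  let ?q = "skip p1 d"
  have bq: "bij_betw ?q (D - {d}) (D - {d})" by (rule bij_betw_skip[OF fin bp1 d p1dd])
  have qe: "?q e = s e" by (simp add: skip_def p1e p1d)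
  have bk: "bij_betw k ?D ?D"
    using bij_betw_skip[OF _ bq, of e] fin e qe se by (simp add: k_def dd)
  have ok: "orbs k ?D = (\<lambda>A. A - {d, e}) ` orbs p1 D"
  proof -
    have "orbs k ?D = (\<lambda>A. A - {e}) ` orbs ?q (D - {d})"
      using orbs_skip[OF _ bq, of e] fin e qe se by (simp add: k_def dd)
    also have "orbs ?q (D - {d}) = (\<lambda>A. A - {d}) ` orbs p1 D"
      by (rule orbs_skip[OF fin bp1 d p1dd])
    finally show ?thesis by (simp add: image_image Diff_insert2[symmetric] insert_commute)
  qed
  have kg: "(g \<circ> rv) y = k y" if y: "y \<in> ?D" for y
  proof -
    have z: "rv y \<in> D" "rv y \<noteq> d" "rv y \<noteq> e"
      using y rvD rv_rv[of y] by (auto simp: e_def simp del: rv_rv)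
    have "p1 y = s (rv y)" using p1 y by auto
    moreover have "s (rv y) \<noteq> d" using sD[OF z(1,2)] by simp
    ultimately have "?q y = s (rv y)" by (simp add: skip_def)
    then show ?thesis by (simp add: k_def g_def skip_def[of _ e] qe)
  qed
  have ogk: "orbs (g \<circ> rv) ?D = (\<lambda>A. A - {d, e}) ` orbs p1 D"
    by (rule trans[OF orbs_cong[OF bk kg] ok])
  \<comment> \<open>\<open>p1\<close> leads from \<open>e\<close> to \<open>d\<close> and on to
    \<open>s e\<close>, which is neither \<open>d\<close> nor \<open>e\<close>, so no orbit is
    confined to these two darts.\<close>
  have ne: "A - {d, e} \<noteq> {}" if A: "A \<in> orbs p1 D" for A
  proof
    assume "A - {d, e} = {}"
    then have sub: "A \<subseteq> {d, e}" by blast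
    obtain x where x: "x \<in> D" "A = orb p1 x" using A by (auto simp: orbs_def)
    have "d \<in> A" using sub x orb_self[of x p1] orb_step[of e p1 x] p1e by auto
    then have "s e \<in> A" using orb_step[of d p1 x] x p1d by simp
    then show False using sub sD[OF e(1,2)] se by blast
  qed
  have "card (balanced H p D) \<le> Suc (card (balanced H p1 D))"
    unfolding p1_def by (rule card_balanced_transpose[OF fin bp d fdD fd[symmetric]])
  also have "card (balanced H p1 D) = card (balanced H (g \<circ> rv) ?D)"
    by (rule card_balanced_image[OF fin bp1 ogk _ ne, symmetric]) (use Hd in \<open>auto simp: e_def\<close>)
  finally have bal: "card (balanced H p D) \<le> Suc (card (balanced H (g \<circ> rv) ?D))" .
  have contr: "orbs (g \<circ> rv) ?D = insert (orb p d \<union> orb p e - {d, e}) (orbs p D - {orb p d, orb p e})"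
    if neq: "orb p d \<noteq> orb p e"
  proof -
    \<comment> \<open>Since \<open>p e = f d\<close>, the transposition joins the
      \<open>p\<close>-orbits of \<open>d\<close> and \<open>e\<close>.\<close>
    have fdp: "orb p (f d) = orb p e"
      using orb_eq[OF fin bp e(1), of "p e"] orb_step[OF orb_self, of p e] by (simp add: p_def e(3))
    have "orbs p1 D = insert (orb p d \<union> orb p e) (orbs p D - {orb p d, orb p e})"
      using orbs_transpose_merge[OF fin bp d fdD] neq by (simp add: fdp p1_def)
    moreover have "A - {d, e} = A" if "A \<in> orbs p D - {orb p d, orb p e}" for A
      using that orbs_eq_orb(1)[OF fin bp, of A] by blast
    ultimately show ?thesis unfolding ogk by simp
  qed
  show thesis
    by (rule that[OF bg[unfolded e_def] og[unfolded e_def] bal[unfolded e_def p_def]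
          contr[unfolded e_def p_def]])
qed

lemma card_remove_edge:
  assumes "finite D" "rv ` D \<subseteq> D" "d \<in> D"
  shows "card D = card (D - {d, rv d}) + 2"
proof -
  have "{d, rv d} \<subseteq> D" using assms by auto
  moreover have "card {d, rv d} = 2" using rv_neq[of d] by (simp add: eq_commute)
  ultimately show ?thesis using assms(1) by (metis card_Diff_subset card_mono finite.intros le_add_diff_inverse2)
qed

lemma rv_remove_edge:
  assumes "rv ` D \<subseteq> D"
  shows "rv ` (D - {d, rv d}) \<subseteq> D - {d, rv d}"
proof
  fix y assume "y \<in> rv ` (D - {d, rv d})"
  then obtain x where "x \<in> D" "x \<noteq> d" "x \<noteq> rv d" "y = rv x" by blast
  then show "y \<in> D - {d, rv d}" using assms rv_rv[of x] by (auto simp del: rv_rv)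
qed

text \<open>Each node keeps a dart, so the number of balanced nodes is unchanged and the loss of at
  most one falls on the faces alone.\<close>

lemma delete_edge:
  assumes fin: "finite D" and bij: "bij_betw f D D" and rvD: "rv ` D \<subseteq> D"
    and d: "d \<in> D" and Hd: "H d = 0"
    and ne: "\<And>A. A \<in> orbs f D \<Longrightarrow> A - {d, rv d} \<noteq> {}"
  obtains g where
    "bij_betw g (D - {d, rv d}) (D - {d, rv d})"
    "\<And>y. y \<in> D - {d, rv d} \<Longrightarrow> orb g y = orb f y - {d, rv d}"
    "orbs g (D - {d, rv d}) = (\<lambda>A. A - {d, rv d}) ` orbs f D"
    "card (balanced H f D) + card (balanced H (f \<circ> rv) D) \<le>
      Suc (card (balanced H g (D - {d, rv d})) + card (balanced H (g \<circ> rv) (D - {d, rv d})))"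
proof -
  let ?S = "{d, rv d}"
  have "orb f d \<in> orbs f D" "orb f (rv d) \<in> orbs f D" using d rvD by (auto simp: orbs_def)
  then have "\<not> orb f d \<subseteq> ?S" "\<not> orb f (rv d) \<subseteq> ?S" using ne by blast+
  from remove_edge[OF fin bij rvD d Hd this] obtain g where
    g: "bij_betw g (D - ?S) (D - ?S)" and og: "orbs g (D - ?S) = (\<lambda>A. A - ?S) ` orbs f D"
    and bal: "card (balanced H (f \<circ> rv) D) \<le> Suc (card (balanced H (g \<circ> rv) (D - ?S)))" by metis
  have "card (balanced H g (D - ?S)) = card (balanced H f D)"
    by (rule card_balanced_image[OF fin bij og _ ne]) (use Hd in auto)
  moreover have "orb g y = orb f y - ?S" if y: "y \<in> D - ?S" for y
  proof -
    have "orb g y \<in> orbs g (D - ?S)" using y by (simp add: orbs_def)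
    then obtain A where A: "A \<in> orbs f D" "orb g y = A - ?S" using og by auto
    then have "y \<in> A" using orb_self[of y g] by auto
    then show ?thesis using orbs_eq_orb(1)[OF fin bij A(1)] A(2) by simp
  qed
  ultimately show ?thesis using that[OF g _ og] bal by simp
qed

text \<open>The dual use of \<open>remove_edge\<close>, applied to the face permutation
  \<open>f \<circ> rv\<close>: now the number of balanced faces is kept while the two end nodes
  merge.\<close>

lemma contract_edge:
  assumes fin: "finite D" and bij: "bij_betw f D D" and rvD: "rv ` D \<subseteq> D"
    and d: "d \<in> D" and Hd: "H d = 0" and neq: "orb f d \<noteq> orb f (rv d)"
    and ne: "\<not> orb f d \<union> orb f (rv d) \<subseteq> {d, rv d}"
  obtains g where
    "bij_betw g (D - {d, rv d}) (D - {d, rv d})"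
    "\<And>y. y \<in> D - {d, rv d} \<Longrightarrow> orb g y =
      (if y \<in> orb f d \<union> orb f (rv d) then orb f d \<union> orb f (rv d) - {d, rv d} else orb f y)"
    "card (balanced H f D) + card (balanced H (f \<circ> rv) D) \<le>
      Suc (card (balanced H g (D - {d, rv d})) + card (balanced H (g \<circ> rv) (D - {d, rv d})))"
proof -
  let ?S = "{d, rv d}" and ?p = "f \<circ> rv"
  have bp: "bij_betw ?p D D" by (rule bij_betw_comp_rv[OF bij rvD])
  have e: "rv d \<in> D" using rvD d by auto
  have pp: "?p \<circ> rv = f" by (simp add: fun_eq_iff)
  have single: "orb f x \<subseteq> {x}" if "f x = x" for x using that by (intro orb_least) auto
  have disj: "orb f d \<inter> orb f (rv d) = {}" by (rule orb_disjoint[OF fin bij d e neq])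
  have fne: "f (rv d) \<noteq> d" "f d \<noteq> rv d"
    using disj orb_self[of d f] orb_self[of "rv d" f] orb_step[of "rv d" f "rv d"] orb_step[of d f d]
    by auto
  have not_fix: "\<not> (f d = d \<and> f (rv d) = rv d)" using single ne by blast
  \<comment> \<open>A face running along \<open>d\<close> and \<open>rv d\<close> only would force
    both ends of the edge to be leaves; such an isolated edge is excluded by
    \<open>ne\<close>.\<close>
  have not_sub: "\<not> C \<subseteq> ?S" if C: "d \<in> C \<or> rv d \<in> C" "\<And>y. y \<in> C \<Longrightarrow> ?p y \<in> C" for C
  proof
    assume "C \<subseteq> ?S"
    then have "d \<in> C \<Longrightarrow> f (rv d) = rv d" "rv d \<in> C \<Longrightarrow> f d = d"
      using C(2)[of d] C(2)[of "rv d"] fne by auto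
    then show False using C(1) C(2)[of d] C(2)[of "rv d"] not_fix by auto
  qed
  have ne1: "\<not> orb ?p d \<subseteq> ?S" and ne2: "\<not> orb ?p (rv d) \<subseteq> ?S"
    by (rule not_sub; simp add: orb_self orb_step del: o_apply)+
  from remove_edge[OF fin bp rvD d Hd ne1 ne2, unfolded pp] neq obtain g where
    g: "bij_betw g (D - ?S) (D - ?S)" and og: "orbs g (D - ?S) = (\<lambda>A. A - ?S) ` orbs ?p D"
    and bal: "card (balanced H f D) \<le> Suc (card (balanced H (g \<circ> rv) (D - ?S)))"
    and ogr: "orbs (g \<circ> rv) (D - ?S) =
      insert (orb f d \<union> orb f (rv d) - ?S) (orbs f D - {orb f d, orb f (rv d)})"
    by metis
  have gr: "bij_betw (g \<circ> rv) (D - ?S) (D - ?S)"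
    by (rule bij_betw_comp_rv[OF g rv_remove_edge[OF rvD]])
  have grr: "g \<circ> rv \<circ> rv = g" by (simp add: fun_eq_iff)
  have nep: "A - ?S \<noteq> {}" if A: "A \<in> orbs ?p D" for A
  proof
    assume AS: "A - ?S = {}"
    obtain x where "x \<in> A" using A orb_self unfolding orbs_def by fast
    then have "A = orb ?p d \<or> A = orb ?p (rv d)" using AS orbs_eq_orb(1)[OF fin bp A] by blast
    then show False using ne1 ne2 AS by blast
  qed
  have "card (balanced H g (D - ?S)) = card (balanced H ?p D)"
    by (rule card_balanced_image[OF fin bp og _ nep]) (use Hd in auto)
  then have total: "card (balanced H f D) + card (balanced H ?p D) \<le>
      Suc (card (balanced H (g \<circ> rv) (D - ?S)) + card (balanced H (g \<circ> rv \<circ> rv) (D - ?S)))"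
    using bal by (simp add: grr)
  have "orb (g \<circ> rv) y =
      (if y \<in> orb f d \<union> orb f (rv d) then orb f d \<union> orb f (rv d) - ?S else orb f y)"
    if y: "y \<in> D - ?S" for y
  proof -
    have mem: "orb (g \<circ> rv) y \<in> orbs (g \<circ> rv) (D - ?S)" using y by (simp add: orbs_def)
    have yy: "y \<in> orb (g \<circ> rv) y" by (rule orb_self)
    show ?thesis
    proof (cases "y \<in> orb f d \<union> orb f (rv d)")
      case True
      then have "orb f y \<in> {orb f d, orb f (rv d)}" using orb_eq[OF fin bij] d e by blast
      then have "orb (g \<circ> rv) y \<notin> orbs f D - {orb f d, orb f (rv d)}"
        using orbs_eq_orb(1)[OF fin bij _ yy] by auto
      then show ?thesis using mem ogr True by auto
    next
      case False
      then have "orb (g \<circ> rv) y \<in> orbs f D" using mem yy ogr by auto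
      then show ?thesis using orbs_eq_orb(1)[OF fin bij _ yy] False by auto
    qed
  qed
  then show ?thesis using that[OF gr _ total] by blast
qed

end

subsection \<open>Counting sign changes\<close>

lemma card_orbs:
  assumes "finite D" "bij_betw f D D"
  shows "card {x \<in> D. P x} = (\<Sum>A\<in>orbs f D. card {x \<in> A. P x})"
proof -
  have *: "card {x \<in> A. P x} = (\<Sum>x\<in>A. if P x then 1 else 0)" if "finite A" for A
    using that by (simp add: sum.If_cases Int_def)
  have fin: "finite A" if "A \<in> orbs f D" for A
    using that Union_orbs[OF assms(2)] assms(1) by (metis Union_upper finite_subset)
  show ?thesis
    using sum_orbs[OF assms, of "\<lambda>x. if P x then 1 else 0 :: nat"] * fin assms(1) by simp
qed

lemma orbit_change:
  assumes fin: "finite D" and bij: "bij_betw f D D" and A: "A \<in> orbs f D"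
    and x: "x \<in> A" "s x" and y: "y \<in> A" "\<not> s y"
  shows "\<exists>z\<in>A. s z \<and> \<not> s (f z)"
proof (rule ccontr)
  assume no: "\<not> ?thesis"
  have Ax: "A = orb f x" by (rule orbs_eq_orb[OF fin bij A x(1)])
  have "orb f x \<subseteq> {z \<in> A. s z}"
    by (rule orb_least) (use no x Ax orb_step[of _ f x] in auto)
  then show False using y Ax by auto
qed

text \<open>Around a cycle on which both values occur, \<open>s\<close> must switch from true to
  false somewhere and back somewhere else.\<close>

lemma orbit_changes_ge_2:
  fixes s :: "'a \<Rightarrow> bool"
  assumes fin: "finite D" and bij: "bij_betw f D D" and A: "A \<in> orbs f D"
    and x: "x \<in> A" "s x" and y: "y \<in> A" "\<not> s y"
  shows "2 \<le> card {z \<in> A. s (f z) \<noteq> s z}"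
proof -
  obtain z where z: "z \<in> A" "s z" "\<not> s (f z)"
    using orbit_change[of D f A x s y, OF fin bij A x y] by blast
  obtain w where w: "w \<in> A" "\<not> s w" "s (f w)"
    using orbit_change[of D f A y "\<lambda>z. \<not> s z" x, OF fin bij A y] x by auto
  have "finite A" using A Union_orbs[OF bij] fin by (metis Union_upper finite_subset)
  then have "card {z, w} \<le> card {z \<in> A. s (f z) \<noteq> s z}"
    using z w by (intro card_mono) auto
  moreover have "z \<noteq> w" using z w by auto
  ultimately show ?thesis by simp
qed

text \<open>Colouring by the parity of the first hitting time from \<open>x\<close> alternates at
  every step except perhaps the closing one into \<open>x\<close>, which fails if the length is odd;
  hence the \<open>Suc\<close>.\<close>

lemma alternating_on_orbit:
  assumes fin: "finite D" and bij: "bij_betw f D D" and x: "x \<in> D"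
  obtains c :: "'a \<Rightarrow> bool" where "card (orb f x) \<le> Suc (card {z \<in> orb f x. c (f z) \<noteq> c z})"
proof -
  define idx where "idx z = (LEAST i. (f ^^ i) x = z)" for z
  have idx: "(f ^^ idx z) x = z" if "z \<in> orb f x" for z
  proof -
    have "\<exists>i. (f ^^ i) x = z" using that by (auto simp: orb_def)
    then show ?thesis unfolding idx_def by (rule LeastI_ex)
  qed
  have least: "idx z \<le> i" if "(f ^^ i) x = z" for z i
    unfolding idx_def using that by (rule Least_le)
  have sub: "orb f x \<subseteq> D" by (rule orb_subset[OF bij x])
  have pows: "(f ^^ i) x \<in> D" for i using sub by (auto simp: orb_def)
  have inj: "inj_on f D" using bij by (simp add: bij_betw_def)
  define c where "c z = even (idx z)" for z
  have change: "c (f z) \<noteq> c z" if z: "z \<in> orb f x" "f z \<noteq> x" for z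
  proof -
    have fz: "f z \<in> orb f x" using orb_step z by fast
    have "idx (f z) \<noteq> 0" using idx[OF fz] z(2) by (metis funpow_0)
    then obtain j where j: "idx (f z) = Suc j" using not0_implies_Suc by blast
    then have "f ((f ^^ j) x) = f z" using idx[OF fz] by simp
    then have "(f ^^ j) x = z" using inj pows z(1) sub by (meson inj_onD subsetD)
    then have "idx z \<le> j" by (rule least)
    moreover have "idx (f z) \<le> Suc (idx z)" using least[of "Suc (idx z)" "f z"] idx[OF z(1)] by simp
    ultimately have "idx (f z) = Suc (idx z)" using j by simp
    then show ?thesis by (simp add: c_def)
  qed
  obtain y where y: "y \<in> D" "f y = x" using bij x by (metis bij_betw_def imageE)
  have "orb f x \<subseteq> insert y {z \<in> orb f x. c (f z) \<noteq> c z}"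
    using change sub inj y by (auto simp: inj_on_def)
  moreover have fo: "finite (orb f x)" using sub fin finite_subset by blast
  ultimately have "card (orb f x) \<le> card (insert y {z \<in> orb f x. c (f z) \<noteq> c z})"
    by (intro card_mono) auto
  also have "\<dots> \<le> Suc (card {z \<in> orb f x. c (f z) \<noteq> c z})"
    by (rule card_insert_le_m1) simp_all
  finally show ?thesis by (rule that)
qed

lemma balanced_both_signs:
  fixes H :: "'a \<Rightarrow> real"
  assumes "finite A" "sum H A = 0" "x \<in> A" "H x \<noteq> 0"
  obtains y z where "y \<in> A" "H y > 0" "z \<in> A" "H z < 0"
proof -
  have "\<exists>y\<in>A. H y > 0"
  proof (rule ccontr)
    assume "\<not> ?thesis"
    then have "\<forall>y\<in>A. 0 \<le> - H y" by force
    then show False using sum_nonneg_eq_0_iff[of A "\<lambda>y. - H y"] assms by (auto simp: sum_negf)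
  qed
  moreover have "\<exists>y\<in>A. H y < 0"
  proof (rule ccontr)
    assume "\<not> ?thesis"
    then have "\<forall>y\<in>A. 0 \<le> H y" by force
    then show False using sum_nonneg_eq_0_iff[of A H] assms by auto
  qed
  ultimately show ?thesis using that by blast
qed

section \<open>Sign counting, and the reduction to a hub with spokes\<close>

context weighted_darts
begin

text \<open>A corner between two edges is a sign change either for its node or for its face.\<close>

lemma card_sign_changes:
  fixes s :: "'d \<Rightarrow> bool"
  assumes fin: "finite D" and rvD: "rv ` D \<subseteq> D" and s: "\<And>x. x \<in> D \<Longrightarrow> s (rv x) \<longleftrightarrow> \<not> s x"
  shows "card {x \<in> D. s (f x) \<noteq> s x} + card {x \<in> D. s ((f \<circ> rv) x) \<noteq> s x} = card D"
proof -
  \<comment> \<open>The face corner at \<open>x\<close> is the node corner at \<open>rv x\<close>;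
    as \<open>s\<close> flips under reversal, exactly one of the two readings sees a change.\<close>
  have "{x \<in> D. s ((f \<circ> rv) x) \<noteq> s x} = rv ` {x \<in> D. s (f x) = s x}"
  proof (intro equalityI subsetI)
    fix x assume "x \<in> {x \<in> D. s ((f \<circ> rv) x) \<noteq> s x}"
    then have "rv x \<in> {x \<in> D. s (f x) = s x}" using rvD s by auto
    then show "x \<in> rv ` {x \<in> D. s (f x) = s x}" by (metis imageI rv_rv)
  qed (use rvD s in auto)
  moreover have "inj_on rv A" for A by (rule inj_on_inverseI[where g = rv]) simp
  ultimately have "card {x \<in> D. s ((f \<circ> rv) x) \<noteq> s x} = card {x \<in> D. s (f x) = s x}"
    by (simp add: card_image)
  moreover have "card D = card {x \<in> D. s (f x) \<noteq> s x} + card {x \<in> D. s (f x) = s x}"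
    using fin by (subst card_Un_disjoint[symmetric]) (auto intro: arg_cong[of _ _ card])
  ultimately show ?thesis by simp
qed

text \<open>In the reduced graph the hub \<Omega> consists of the spokes \<open>K\<close> alone, and
  they are the only zero edges. The constant 3 is 2 + 1: \<Omega> is counted with the usual 2 on top
  of \<open>card K\<close>, and the alternation may fail once.\<close>

lemma star_bound:
  assumes fin: "finite D" and bij: "bij_betw f D D" and rvD: "rv ` D \<subseteq> D"
    and Om: "\<Omega> \<in> orbs f D" and zero: "\<And>x. x \<in> \<Omega> \<Longrightarrow> H x = 0"
    and K: "K \<subseteq> \<Omega>" and out: "\<And>x. x \<in> K \<Longrightarrow> rv x \<notin> \<Omega>"
    and supp: "\<And>A. A \<in> orbs f D \<Longrightarrow> A \<noteq> \<Omega> \<Longrightarrow> \<exists>x\<in>A. H x \<noteq> 0"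
    and dist: "\<And>x y. x \<in> K \<Longrightarrow> y \<in> K \<Longrightarrow> orb f (rv x) = orb f (rv y) \<Longrightarrow> x = y"
    and star: "\<And>x. x \<in> D \<Longrightarrow> H x = 0 \<Longrightarrow> x \<in> K \<or> rv x \<in> K"
  shows "card K + 2 * card (balanced H f D) + 2 * card (balanced H (f \<circ> rv) D) \<le> card D + 3"
proof -
  have OmD: "\<Omega> \<subseteq> D" using Om Union_orbs[OF bij] by blast
  have rvK: "rv x \<notin> K" if "x \<in> \<Omega>" for x using out[of "rv x"] that by auto
  have OmK: "\<Omega> = K" using K star zero OmD rvK by blast
  obtain x0 where x0: "x0 \<in> D" "\<Omega> = orb f x0" using Om by (auto simp: orbs_def)
  obtain c :: "'d \<Rightarrow> bool" where c: "card \<Omega> \<le> Suc (card {z \<in> \<Omega>. c (f z) \<noteq> c z})"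
    using alternating_on_orbit[OF fin bij x0(1)] x0(2) by auto
  \<comment> \<open>Each spoke takes the alternating colour \<open>c\<close> at the hub and the
    opposite one at its far end, so that \<open>s\<close> flips under reversal just as the sign of
    \<open>H\<close> does.\<close>
  define s where "s x = (if H x \<noteq> 0 then H x > 0 else if x \<in> \<Omega> then c x else \<not> c (rv x))" for x
  have s: "s (rv x) \<longleftrightarrow> \<not> s x" if x: "x \<in> D" for x
  proof (cases "H x = 0")
    case True
    then consider "x \<in> \<Omega>" "rv x \<notin> \<Omega>" | "rv x \<in> \<Omega>" "x \<notin> \<Omega>"
      using star[OF x] rvK OmK rv_rv[of x] by metis
    then show ?thesis using True by cases (auto simp: s_def)
  qed (auto simp: s_def)
  have finA: "finite A" if "A \<in> orbs p D" "bij_betw p D D" for A p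
    using that Union_orbs[OF that(2)] fin by (metis Union_upper finite_subset)
  have two: "2 \<le> card {z \<in> A. s (p z) \<noteq> s z}"
    if p: "bij_betw p D D" and A: "A \<in> balanced H p D" and x: "x \<in> A" "H x \<noteq> 0" for p A x
  proof -
    have A': "A \<in> orbs p D" "sum H A = 0" using A by (auto simp: balanced_def)
    obtain y z where "y \<in> A" "H y > 0" "z \<in> A" "H z < 0"
      by (rule balanced_both_signs[OF finA[OF A'(1) p] A'(2) x])
    then show ?thesis by (intro orbit_changes_ge_2[OF fin p A'(1), of y s z]) (auto simp: s_def)
  qed
  have nodes: "card K + 2 * card (balanced H f D) \<le> card {x \<in> D. s (f x) \<noteq> s x} + 3"
  proof -
    have Ob: "\<Omega> \<in> balanced H f D" using Om zero by (simp add: balanced_def)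
    have fb: "finite (balanced H f D)" using finite_orbs[OF fin] by (simp add: balanced_def)
    have "s z = c z" if "z \<in> \<Omega>" for z using that zero by (simp add: s_def)
    moreover have "f z \<in> \<Omega>" if "z \<in> \<Omega>" for z using that x0 orb_step by fast
    ultimately have "{z \<in> \<Omega>. c (f z) \<noteq> c z} = {z \<in> \<Omega>. s (f z) \<noteq> s z}" by auto
    then have "card K + 2 * card (balanced H f D - {\<Omega>})
        \<le> Suc (card {z \<in> \<Omega>. s (f z) \<noteq> s z}) + (\<Sum>A\<in>balanced H f D - {\<Omega>}. 2)"
      using c OmK by simp
    also have "(\<Sum>A\<in>balanced H f D - {\<Omega>}. 2)
        \<le> (\<Sum>A\<in>balanced H f D - {\<Omega>}. card {z \<in> A. s (f z) \<noteq> s z})"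
    proof (rule sum_mono)
      fix A assume A: "A \<in> balanced H f D - {\<Omega>}"
      then obtain x where "x \<in> A" "H x \<noteq> 0" using supp[of A] by (auto simp: balanced_def)
      then show "2 \<le> card {z \<in> A. s (f z) \<noteq> s z}" using two[OF bij] A by blast
    qed
    also have "Suc (card {z \<in> \<Omega>. s (f z) \<noteq> s z})
        + (\<Sum>A\<in>balanced H f D - {\<Omega>}. card {z \<in> A. s (f z) \<noteq> s z})
        = Suc (\<Sum>A\<in>balanced H f D. card {z \<in> A. s (f z) \<noteq> s z})"
      using fb Ob by (simp add: sum.remove)
    also have "\<dots> \<le> Suc (\<Sum>A\<in>orbs f D. card {z \<in> A. s (f z) \<noteq> s z})"
      using finite_orbs[OF fin] by (auto intro: sum_mono2 simp: balanced_def)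
    also have "\<dots> = Suc (card {x \<in> D. s (f x) \<noteq> s x})"
      using card_orbs[OF fin bij] by simp
    finally show ?thesis using Ob fb by (simp add: card_Diff_singleton)
  qed
  have bp: "bij_betw (f \<circ> rv) D D" by (rule bij_betw_comp_rv[OF bij rvD])
  \<comment> \<open>If the dart following the far end of a spoke at its node were zero, it would be
    the far end of a spoke to the same node, hence by \<open>dist\<close> of the same spoke. The
    node would then be this single zero dart, against \<open>supp\<close>.\<close>
  have face1: "H (f (rv x)) \<noteq> 0" if x: "x \<in> K" for x
  proof
    let ?z = "f (rv x)"
    assume Hz: "H ?z = 0"
    have rx: "rv x \<in> D" using x OmK OmD rvD by auto
    have z: "?z \<in> orb f (rv x)" by (rule orb_step[OF orb_self])
    have oz: "orb f ?z = orb f (rv x)" by (rule orb_eq[OF fin bij rx z])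
    have neO: "orb f (rv x) \<noteq> \<Omega>" using out[OF x] orb_self[of "rv x" f] by auto
    have "?z \<notin> \<Omega>"
      using orbs_eq_orb(1)[OF fin bij Om, of ?z] oz neO by auto
    then have "rv ?z \<in> K" using star[OF bij_mem[OF bij rx] Hz] OmK by blast
    then have "rv ?z = x" using dist[of "rv ?z" x] x oz by simp
    then have fixed: "?z = rv x" by (metis rv_rv)
    then have "orb f (rv x) \<subseteq> {rv x}" by (intro orb_least) auto
    then have "H y = 0" if "y \<in> orb f (rv x)" for y using that Hz fixed by auto
    moreover have "orb f (rv x) \<in> orbs f D" using rx by (simp add: orbs_def)
    ultimately show False using supp neO by blast
  qed
  have faces: "2 * card (balanced H (f \<circ> rv) D) \<le> card {x \<in> D. s ((f \<circ> rv) x) \<noteq> s x}"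
  proof -
    have "2 * card (balanced H (f \<circ> rv) D) = (\<Sum>A\<in>balanced H (f \<circ> rv) D. 2)" by simp
    also have "\<dots> \<le> (\<Sum>A\<in>balanced H (f \<circ> rv) D. card {z \<in> A. s ((f \<circ> rv) z) \<noteq> s z})"
    proof (rule sum_mono)
      fix A assume A: "A \<in> balanced H (f \<circ> rv) D"
      then obtain x where x: "x \<in> D" "A = orb (f \<circ> rv) x" by (auto simp: balanced_def orbs_def)
      have step: "f (rv y) \<in> A" if "y \<in> A" for y using orb_step[of y "f \<circ> rv" x] that x by simp
      have xA: "x \<in> A" using x orb_self[of x] by simp
      \<comment> \<open>From a spoke leaving the hub the face reaches the support in one step; from
        one entering the hub the next dart is a spoke leaving it, so two steps suffice.\<close>
      have "\<exists>y\<in>A. H y \<noteq> 0"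
      proof (cases "H x = 0")
        case True
        from star[OF x(1) this] show ?thesis
        proof
          assume "x \<in> K"
          then show ?thesis using face1 step[OF xA] by blast
        next
          assume "rv x \<in> K"
          then have "f (rv x) \<in> K" using OmK x0(2) orb_step by fast
          then show ?thesis using face1 step[OF step[OF xA]] by blast
        qed
      qed (use xA in blast)
      then show "2 \<le> card {z \<in> A. s ((f \<circ> rv) z) \<noteq> s z}" using two[OF bp A] by blast
    qed
    also have "\<dots> \<le> (\<Sum>A\<in>orbs (f \<circ> rv) D. card {z \<in> A. s ((f \<circ> rv) z) \<noteq> s z})"
      using finite_orbs[OF fin] by (auto intro: sum_mono2 simp: balanced_def)
    finally show ?thesis using card_orbs[OF fin bp] by simp
  qed
  show ?thesis using nodes faces card_sign_changes[where f = f and s = s, OF fin rvD s] by linarith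
qed

text \<open>Deleting zero edges other than spokes never empties a node: \<Omega> keeps
  \<open>K\<close>, all others keep a dart of non-zero weight. Each deletion lowers
  \<open>card D\<close> by 2 and twice the number of balanced orbits by at most 2, so the inequality
  passes back to the larger graph.\<close>

lemma deletion_bound:
  assumes "finite D" "bij_betw f D D" "rv ` D \<subseteq> D"
    and "\<Omega> \<in> orbs f D" "\<And>x. x \<in> \<Omega> \<Longrightarrow> H x = 0"
    and "K \<subseteq> \<Omega>" "K \<noteq> {}" "\<And>x. x \<in> K \<Longrightarrow> rv x \<notin> \<Omega>"
    and "\<And>A. A \<in> orbs f D \<Longrightarrow> A \<noteq> \<Omega> \<Longrightarrow> \<exists>x\<in>A. H x \<noteq> 0"
    and "\<And>x y. x \<in> K \<Longrightarrow> y \<in> K \<Longrightarrow> orb f (rv x) = orb f (rv y) \<Longrightarrow> x = y"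
  shows "card K + 2 * card (balanced H f D) + 2 * card (balanced H (f \<circ> rv) D) \<le> card D + 3"
  using assms
proof (induction "card D" arbitrary: D f \<Omega> rule: less_induct)
  case less
  note fin = less.prems(1) and bij = less.prems(2) and rvD = less.prems(3)
    and Om = less.prems(4) and zero = less.prems(5) and K = less.prems(6) and Kne = less.prems(7)
    and out = less.prems(8) and supp = less.prems(9) and dist = less.prems(10)
  show ?case
  proof (cases "\<forall>x\<in>D. H x = 0 \<longrightarrow> x \<in> K \<or> rv x \<in> K")
    case True
    then show ?thesis
      by (intro star_bound[OF fin bij rvD Om zero K out supp dist]) auto
  next
    case False
    then obtain d where d: "d \<in> D" "H d = 0" "d \<notin> K" "rv d \<notin> K" by blast
    let ?S = "{d, rv d}" and ?D = "D - {d, rv d}"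
    have ne: "A - ?S \<noteq> {}" if A: "A \<in> orbs f D" for A
    proof (cases "A = \<Omega>")
      case True
      then show ?thesis using K Kne d by blast
    next
      case False
      then obtain x where "x \<in> A" "H x \<noteq> 0" using supp A by blast
      then show ?thesis using d(2) by auto
    qed
    obtain g where g: "bij_betw g ?D ?D"
      and og: "\<And>y. y \<in> ?D \<Longrightarrow> orb g y = orb f y - ?S"
      and orbs: "orbs g ?D = (\<lambda>A. A - ?S) ` orbs f D"
      and bal: "card (balanced H f D) + card (balanced H (f \<circ> rv) D) \<le>
        Suc (card (balanced H g ?D) + card (balanced H (g \<circ> rv) ?D))"
      using delete_edge[OF fin bij rvD d(1,2) ne] by metis
    have card: "card D = card ?D + 2" by (rule card_remove_edge[OF fin rvD d(1)])
    have KD: "rv x \<in> ?D" if "x \<in> K" for x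
      using that K Om Union_orbs[OF bij] rvD d(3,4) rv_rv[of x] by auto
    have "card K + 2 * card (balanced H g ?D) + 2 * card (balanced H (g \<circ> rv) ?D) \<le> card ?D + 3"
    proof (rule less.hyps[OF _ _ g rv_remove_edge[OF rvD], where \<Omega> = "\<Omega> - ?S"])
      show "card ?D < card D" using card by simp
      show "\<Omega> - ?S \<in> orbs g ?D" using orbs Om by blast
      show "\<exists>x\<in>A. H x \<noteq> 0" if A: "A \<in> orbs g ?D" "A \<noteq> \<Omega> - ?S" for A
      proof -
        obtain B where B: "B \<in> orbs f D" "A = B - ?S" using A orbs by auto
        then obtain x where "x \<in> B" "H x \<noteq> 0" using supp A by blast
        then show ?thesis using B d(2) by (intro bexI[of _ x]) auto
      qed
      show "x = y" if xy: "x \<in> K" "y \<in> K" "orb g (rv x) = orb g (rv y)" for x y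
      proof -
        have "rv x \<in> orb f (rv y)" using og[OF KD[OF xy(2)]] xy(3) orb_self[of "rv x" g] by auto
        then show ?thesis using dist[OF xy(1,2)] orb_eq[OF fin bij] KD[OF xy(2)] by blast
      qed
    qed (use fin zero K Kne out d in auto)
    then show ?thesis using bal card by linarith
  qed
qed

text \<open>Connectivity is expressed by invariant dart sets because these lift through a
  contraction, with no rerouting of paths: the assumption ending in \<open>T = \<Omega>\<close> says
  that \<Omega> is connected, the final one that no component of the graph carries only zeros. Edges
  leaving \<Omega> end at nodes with support, so \<Omega> is a full component of the zero
  nodes.\<close>

lemma contraction_bound:
  assumes "finite D" "bij_betw f D D" "rv ` D \<subseteq> D"
    and "\<Omega> \<subseteq> D" "f ` \<Omega> \<subseteq> \<Omega>" "\<And>x. x \<in> \<Omega> \<Longrightarrow> H x = 0"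
    and "K \<subseteq> \<Omega>" "K \<noteq> {}" "\<And>x. x \<in> K \<Longrightarrow> rv x \<notin> \<Omega>"
    and "\<And>T. T \<subseteq> \<Omega> \<Longrightarrow> T \<noteq> {} \<Longrightarrow> f ` T \<subseteq> T \<Longrightarrow> (\<And>x. x \<in> T \<Longrightarrow> rv x \<in> \<Omega> \<Longrightarrow> rv x \<in> T) \<Longrightarrow> T = \<Omega>"
    and "\<And>x. x \<in> \<Omega> \<Longrightarrow> rv x \<notin> \<Omega> \<Longrightarrow> \<exists>y\<in>orb f (rv x). H y \<noteq> 0"
    and "\<And>x y. x \<in> K \<Longrightarrow> y \<in> K \<Longrightarrow> orb f (rv x) = orb f (rv y) \<Longrightarrow> x = y"
    and "\<And>T. T \<subseteq> D \<Longrightarrow> T \<noteq> {} \<Longrightarrow> f ` T \<subseteq> T \<Longrightarrow> rv ` T \<subseteq> T \<Longrightarrow> \<exists>x\<in>T. H x \<noteq> 0"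
  shows "card K + 2 * card (balanced H f D) + 2 * card (balanced H (f \<circ> rv) D) \<le> card D + 3"
  using assms
proof (induction "card D" arbitrary: D f \<Omega> rule: less_induct)
  case less
  note fin = less.prems(1) and bij = less.prems(2) and rvD = less.prems(3)
    and OmD = less.prems(4) and fOm = less.prems(5) and zero = less.prems(6)
    and K = less.prems(7) and Kne = less.prems(8) and out = less.prems(9)
    and conn = less.prems(10) and bdry = less.prems(11) and dist = less.prems(12)
    and nz = less.prems(13)
  have orbOm: "orb f x \<subseteq> \<Omega>" if "x \<in> \<Omega>" for x
    using that fOm by (intro orb_least) auto
  show ?case
  \<comment> \<open>An edge is contractible if it joins a zero node to a different node without
    crossing the boundary of \<Omega>; crossing edges stay, as they supply the spokes.\<close>
  proof (cases "\<exists>d\<in>D. (\<forall>x\<in>orb f d. H x = 0) \<and> rv d \<notin> orb f d \<and> (d \<in> \<Omega> \<longleftrightarrow> rv d \<in> \<Omega>)")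
    case False
    then have no: "rv d \<in> orb f d"
      if "d \<in> D" "\<forall>x\<in>orb f d. H x = 0" "d \<in> \<Omega> \<longleftrightarrow> rv d \<in> \<Omega>" for d
      using that by blast
    have Om: "\<Omega> \<in> orbs f D"
    proof -
      obtain x where x: "x \<in> \<Omega>" using K Kne by blast
      have "orb f x = \<Omega>"
      proof (rule conn)
        show "orb f x \<subseteq> \<Omega>" by (rule orbOm[OF x])
        fix y assume y: "y \<in> orb f x" "rv y \<in> \<Omega>"
        have "orb f y = orb f x" using orb_eq[OF fin bij _ y(1)] x OmD by blast
        then show "rv y \<in> orb f x" using no[of y] y OmD orbOm[OF x] zero by blast
      qed (use orb_self orb_step in fast)+
      then show ?thesis using x OmD by (auto simp: orbs_def)
    qed
    show ?thesis
    proof (rule deletion_bound[OF fin bij rvD Om zero K Kne out _ dist])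
      fix A assume A: "A \<in> orbs f D" "A \<noteq> \<Omega>"
      show "\<exists>x\<in>A. H x \<noteq> 0"
      proof (rule ccontr)
        assume "\<not> ?thesis"
        then have Az: "\<forall>x\<in>A. H x = 0" by blast
        have AD: "A \<subseteq> D" using A(1) Union_orbs[OF bij] by blast
        have AOm: "A \<inter> \<Omega> = {}" by (rule orbs_disjoint[OF fin bij A(1) Om A(2)])
        have Ax: "orb f x = A" if "x \<in> A" for x using orbs_eq_orb(1)[OF fin bij A(1) that] by simp
        \<comment> \<open>A zero node outside \<Omega> without contractible edges has only loops,
          since an edge into \<Omega> would give it support by \<open>bdry\<close>. It would thus be
          a whole component without support.\<close>
        have "rv x \<in> A" if x: "x \<in> A" for x
        proof (rule ccontr)
          assume nA: "rv x \<notin> A"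
          then have "rv x \<in> \<Omega>" using no[of x] x AD Az AOm Ax[OF x] by auto
          then show False using bdry[of "rv x"] x AOm Ax[OF x] Az by auto
        qed
        moreover have "f ` A \<subseteq> A" using Ax orb_step by fast
        moreover have "A \<noteq> {}" using A(1) orb_self unfolding orbs_def by fast
        ultimately show False using nz[OF AD] Az by blast
      qed
    qed
  next
    case True
    then obtain d where d: "d \<in> D" and Az: "\<forall>x\<in>orb f d. H x = 0"
      and dA: "rv d \<notin> orb f d" and dOm: "d \<in> \<Omega> \<longleftrightarrow> rv d \<in> \<Omega>" by blast
    let ?S = "{d, rv d}" and ?D = "D - {d, rv d}"
    let ?M = "orb f d \<union> orb f (rv d)"
    have Hd: "H d = 0" using Az orb_self by fast
    have e: "rv d \<in> D" using d rvD by auto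
    have neq: "orb f d \<noteq> orb f (rv d)" using dA orb_self[of "rv d" f] by auto
    have HS: "H x = 0" if "x \<in> ?S" for x using that Hd by auto
    have MD: "?M \<subseteq> D" using orb_subset[OF bij] d e by blast
    have Mcl: "f x \<in> ?M" if "x \<in> ?M" for x using that orb_step by fast
    have SM: "?S \<subseteq> ?M" using orb_self by fast
    have Morb: "orb f x \<subseteq> ?M" if "x \<in> ?M" for x using that orb_mono by fast
    \<comment> \<open>Otherwise the edge would be an isolated component carrying only zeros.\<close>
    have ne: "\<not> ?M \<subseteq> ?S"
    proof
      assume "?M \<subseteq> ?S"
      then have "?M = ?S" using SM by blast
      then have "\<exists>x\<in>?S. H x \<noteq> 0" using Mcl d e by (intro nz) auto
      then show False using HS by blast
    qed
    obtain g where g: "bij_betw g ?D ?D"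
      and og: "\<And>y. y \<in> ?D \<Longrightarrow> orb g y = (if y \<in> ?M then ?M - ?S else orb f y)"
      and bal: "card (balanced H f D) + card (balanced H (f \<circ> rv) D) \<le>
        Suc (card (balanced H g ?D) + card (balanced H (g \<circ> rv) ?D))"
      using contract_edge[OF fin bij rvD d Hd neq ne] by metis
    have card: "card D = card ?D + 2" by (rule card_remove_edge[OF fin rvD d])
    have gsub: "orb f y - ?S \<subseteq> orb g y" if "y \<in> ?D" for y
      using og[OF that] Morb by auto
    have fsub: "orb f y \<subseteq> orb g y \<union> ?S" if "y \<in> ?D" for y
      using gsub[OF that] by blast
    have dK: "d \<notin> K" "rv d \<notin> K" using out[of d] out[of "rv d"] dOm K by auto
    have KD: "rv x \<in> ?D" if "x \<in> K" for x
      using that K OmD rvD dK rv_rv[of x] by auto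
    \<comment> \<open>An invariant set of the contracted graph lifts to the old graph: unchanged if
      it misses the merged node, else with the two removed darts put back. This carries both
      \<open>conn\<close> and \<open>nz\<close> through the induction.\<close>
    have lift: "\<exists>T'. (T' = T \<or> T' = T \<union> ?S) \<and> f ` T' \<subseteq> T' \<and> (T' = T \<union> ?S \<longrightarrow> ?M \<subseteq> T')"
      if T: "T \<subseteq> ?D" "g ` T \<subseteq> T" for T
    proof -
      have og': "orb g y \<subseteq> T" if "y \<in> T" for y using that T by (intro orb_least) auto
      show ?thesis
      proof (cases "T \<inter> ?M = {}")
        case True
        have "f y \<in> T" if y: "y \<in> T" for y
        proof -
          have "y \<in> ?D" "y \<notin> ?M" using y T(1) True by blast+
          then have "orb g y = orb f y" using og by simp
          then show ?thesis using og'[OF y] orb_step[OF orb_self, of f y] by auto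
        qed
        moreover have "d \<notin> T" using T(1) by auto
        ultimately show ?thesis by (intro exI[of _ T]) auto
      next
        case False
        then obtain z where z: "z \<in> T" "z \<in> ?M" by blast
        then have "z \<in> ?D" using T(1) by blast
        then have "?M - ?S \<subseteq> T" using og[of z] og'[OF z(1)] z(2) by simp
        then have M: "?M \<subseteq> T \<union> ?S" by blast
        have "f y \<in> T \<union> ?S" if y: "y \<in> T \<union> ?S" for y
        proof (cases "y \<in> ?M")
          case True
          then show ?thesis using Mcl M by blast
        next
          case False
          then have yT: "y \<in> T" using y SM by blast
          then have "y \<in> ?D" using T(1) by blast
          then have "orb g y = orb f y" using og False by simp
          then show ?thesis using og'[OF yT] orb_step[OF orb_self, of f y] by auto
        qed
        then show ?thesis using M by (intro exI[of _ "T \<union> ?S"]) auto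
      qed
    qed
    have "card K + 2 * card (balanced H g ?D) + 2 * card (balanced H (g \<circ> rv) ?D) \<le> card ?D + 3"
    proof (rule less.hyps[OF _ _ g rv_remove_edge[OF rvD], where \<Omega> = "\<Omega> - ?S"])
      show "card ?D < card D" using card by simp
      show "g ` (\<Omega> - ?S) \<subseteq> \<Omega> - ?S"
      proof
        fix z assume "z \<in> g ` (\<Omega> - ?S)"
        then obtain y where y: "y \<in> \<Omega>" "y \<in> ?D" "z = g y" using OmD by auto
        have z: "z \<in> orb g y" using y orb_step[OF orb_self] by fast
        have "orb g y \<subseteq> \<Omega> - ?S"
        proof (cases "y \<in> ?M")
          case True
          then have "d \<in> orb f y \<or> rv d \<in> orb f y" using orb_sym[OF fin bij] d e by blast
          then have "d \<in> \<Omega>" "rv d \<in> \<Omega>" using orbOm[OF y(1)] dOm by blast+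
          then have "?M \<subseteq> \<Omega>" using orbOm by blast
          then show ?thesis using og[OF y(2)] True by auto
        next
          case False
          then have "orb g y \<subseteq> \<Omega>" using og[OF y(2)] orbOm[OF y(1)] by simp
          moreover have "orb g y \<subseteq> ?D" using orb_subset[OF g y(2)] .
          ultimately show ?thesis by blast
        qed
        then show "z \<in> \<Omega> - ?S" using z by blast
      qed
      show "T = \<Omega> - ?S"
        if T: "T \<subseteq> \<Omega> - ?S" "T \<noteq> {}" "g ` T \<subseteq> T"
          and Trv: "\<And>x. x \<in> T \<Longrightarrow> rv x \<in> \<Omega> - ?S \<Longrightarrow> rv x \<in> T" for T
      proof -
        have "T \<subseteq> ?D" using T(1) OmD by blast
        from lift[OF this T(3)] obtain T' where T': "T' = T \<or> T' = T \<union> ?S" "f ` T' \<subseteq> T'"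
          "T' = T \<union> ?S \<longrightarrow> ?M \<subseteq> T'" by blast
        have rvS: "rv x \<in> ?S \<longleftrightarrow> x \<in> ?S" for x using rv_rv[of x] by auto
        have "T' = \<Omega>"
        proof (rule conn)
          show "T' \<subseteq> \<Omega>"
          proof (cases "T' = T")
            case False
            then have T'S: "T' = T \<union> ?S" "?M \<subseteq> T'" using T' by auto
            obtain z where "z \<in> ?M" "z \<notin> ?S" using ne by blast
            then have z: "z \<in> \<Omega>" "z \<in> ?M" using T'S T(1) by auto
            then have "d \<in> orb f z \<or> rv d \<in> orb f z" using orb_sym[OF fin bij] d e by blast
            then have "?S \<subseteq> \<Omega>" using orbOm[OF z(1)] dOm by blast
            then show ?thesis using T'S T(1) by blast
          qed (use T(1) in auto)
          show "T' \<noteq> {}" using T' T(2) by auto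
          show "f ` T' \<subseteq> T'" by (rule T')
          fix x assume x: "x \<in> T'" "rv x \<in> \<Omega>"
          show "rv x \<in> T'"
          proof (cases "x \<in> ?S")
            case True
            then have "x \<notin> T" using T(1) by blast
            then have "T' = T \<union> ?S" using T'(1) x(1) by auto
            moreover have "rv x \<in> ?S" using True rvS by simp
            ultimately show ?thesis by blast
          next
            case False
            then have "x \<in> T" "rv x \<notin> ?S" using T'(1) x(1) rvS by auto
            then have "rv x \<in> T" using Trv x(2) by blast
            then show ?thesis using T'(1) by blast
          qed
        qed
        then show ?thesis using T'(1) T(1) by blast
      qed
      show "\<exists>y\<in>orb g (rv x). H y \<noteq> 0" if x: "x \<in> \<Omega> - ?S" "rv x \<notin> \<Omega> - ?S" for x
      proof -
        have S: "rv x \<notin> ?S" using x(1) rv_rv[of x] by auto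
        then obtain y where y: "y \<in> orb f (rv x)" "H y \<noteq> 0" using bdry[of x] x by blast
        have "rv x \<in> ?D" using x OmD rvD S by blast
        then have "y \<in> orb g (rv x)" using gsub y HS by blast
        then show ?thesis using y by blast
      qed
      show "x = y" if xy: "x \<in> K" "y \<in> K" "orb g (rv x) = orb g (rv y)" for x y
      proof -
        text \<open>The neighbour at the far end of an edge of K is no zero node, so only the second end of
          the contracted edge can be merged into it.\<close>
        have notA: "rv z \<notin> orb f d" if z: "z \<in> K" for z
        proof
          assume "rv z \<in> orb f d"
          then have "orb f (rv z) = orb f d" using orb_eq[OF fin bij d] by blast
          then show False using bdry[of z] z K out Az by blast
        qed
        have "orb f (rv x) = orb f (rv y)"
        proof (cases "rv x \<in> ?M")
          case True
          then have "rv y \<in> ?M"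
            using og[OF KD[OF xy(1)]] xy(3) orb_self[of "rv y" g] by auto
          then have "rv x \<in> orb f (rv d)" "rv y \<in> orb f (rv d)" using True notA xy by blast+
          then show ?thesis using orb_eq[OF fin bij e] by blast
        next
          case False
          then have "rv y \<in> orb f (rv x)"
            using og[OF KD[OF xy(1)]] xy(3) orb_self[of "rv y" g] by auto
          then show ?thesis using orb_eq[OF fin bij] KD[OF xy(1)] by blast
        qed
        then show ?thesis by (rule dist[OF xy(1,2)])
      qed
      show "\<exists>x\<in>T. H x \<noteq> 0" if T: "T \<subseteq> ?D" "T \<noteq> {}" "g ` T \<subseteq> T" "rv ` T \<subseteq> T" for T
      proof -
        obtain T' where T': "T' = T \<or> T' = T \<union> ?S" "f ` T' \<subseteq> T'" using lift[OF T(1,3)] by blast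
        have "\<exists>x\<in>T'. H x \<noteq> 0" using T' T d e by (intro nz) auto
        then show ?thesis using T'(1) HS by blast
      qed
    qed (use fin zero K Kne out dK OmD in auto)
    then show ?thesis using bal card by linarith
  qed
qed

end

subsection \<open>Rotation systems\<close>

lemma orb_eq_iff:
  assumes "finite D" "bij_betw f D D" "A \<in> orbs f D"
  shows "orb f x = A \<longleftrightarrow> x \<in> A"
  using orbs_eq_orb(1)[OF assms] orb_self[of x f] by blast

text \<open>Translates the edgewise products with \<open>delta_node\<close> and
  \<open>bd_face\<close> into sums over orbits of darts; a loop, or an edge with the same face on
  both sides, cancels in both forms.\<close>

lemma sum_darts:
  fixes H :: "'e \<times> bool \<Rightarrow> real"
  assumes fin: "finite E" and A: "A \<subseteq> darts E"
    and H: "\<And>e. H (e, True) = h e" "\<And>e. H (e, False) = - h e"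
  shows "sum H A = (\<Sum>e\<in>E. h e * ((if (e, True) \<in> A then 1 else 0) - (if (e, False) \<in> A then 1 else 0)))"
proof -
  have "sum H A = (\<Sum>d\<in>darts E. if d \<in> A then H d else 0)"
    using A fin by (subst sum.inter_restrict[symmetric]) (auto simp: darts_def Int_absorb1)
  also have "\<dots> = (\<Sum>e\<in>E. \<Sum>b\<in>UNIV. if (e, b) \<in> A then H (e, b) else 0)"
    unfolding darts_def sum.cartesian_product by (intro sum.cong) auto
  also have "\<dots> = (\<Sum>e\<in>E. h e * ((if (e, True) \<in> A then 1 else 0) - (if (e, False) \<in> A then 1 else 0)))"
    by (intro sum.cong) (auto simp: UNIV_bool H)
  finally show ?thesis .
qed

text \<open>The first exit from \<open>W\<close> along a chain lands in \<open>Y\<close>. With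
  \<open>Y\<close> empty this propagates an invariant along a path; with the actual boundary set it
  finds a separating node.\<close>

lemma chain_invariant:
  assumes step: "\<And>u v. u \<in> W \<Longrightarrow> R u v \<Longrightarrow> v \<in> N \<Longrightarrow> v \<in> W \<or> v \<in> Y"
    and "p \<noteq> []" "set p \<subseteq> N" "hd p \<in> W" "\<And>i. Suc i < length p \<Longrightarrow> R (p ! i) (p ! Suc i)"
  shows "last p \<in> W \<or> set p \<inter> Y \<noteq> {}"
  using assms(2-)
proof (induction p)
  case (Cons v p)
  show ?case
  proof (cases p)
    case Nil
    then show ?thesis using Cons.prems by simp
  next
    case (Cons w q)
    have "R v w" using Cons.prems(4)[of 0] Cons by simp
    then have "w \<in> W \<or> w \<in> Y" using step[of v w] Cons.prems(2,3) Cons by simp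
    moreover have "R (p ! i) (p ! Suc i)" if "Suc i < length p" for i
      using Cons.prems(4)[of "Suc i"] that by simp
    ultimately show ?thesis using Cons.IH Cons.prems(2) Cons by auto
  qed
qed simp

lemma is_path_invariant:
  assumes "\<And>u v. u \<in> W \<Longrightarrow> adjacent E \<sigma> u v \<Longrightarrow> v \<in> N \<Longrightarrow> v \<in> W \<or> v \<in> Y"
    and "is_path E \<sigma> p" "set p \<subseteq> N" "hd p \<in> W"
  shows "last p \<in> W \<or> set p \<inter> Y \<noteq> {}"
  using chain_invariant[of W "adjacent E \<sigma>" N Y p] assms by (auto simp: is_path_def)

lemma adjacent_iff_dart:
  "adjacent E \<sigma> u v \<longleftrightarrow> (\<exists>d\<in>darts E. orb \<sigma> d = u \<and> orb \<sigma> (rev_dart d) = v)"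
proof
  assume "adjacent E \<sigma> u v"
  then obtain e where "e \<in> E"
    "(tl_node \<sigma> e = u \<and> hd_node \<sigma> e = v) \<or> (tl_node \<sigma> e = v \<and> hd_node \<sigma> e = u)"
    unfolding adjacent_def by blast
  then have "\<exists>b. orb \<sigma> (e, b) = u \<and> orb \<sigma> (rev_dart (e, b)) = v" "\<And>b. (e, b) \<in> darts E"
    by (auto simp: tl_node_def hd_node_def rev_dart_def darts_def)
  then show "\<exists>d\<in>darts E. orb \<sigma> d = u \<and> orb \<sigma> (rev_dart d) = v" by blast
next
  assume "\<exists>d\<in>darts E. orb \<sigma> d = u \<and> orb \<sigma> (rev_dart d) = v"
  then obtain e b where "e \<in> E" "orb \<sigma> (e, b) = u" "orb \<sigma> (e, \<not> b) = v"
    by (auto simp: rev_dart_def darts_def)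
  then show "adjacent E \<sigma> u v"
    by (cases b) (auto simp: adjacent_def tl_node_def hd_node_def)
qed

section \<open>The separator and the final count\<close>

theorem mainTheorem6:
  fixes E :: "'e set" and \<sigma> :: "'e \<times> bool \<Rightarrow> 'e \<times> bool"
    and h :: "'e \<Rightarrow> real" and g :: nat and U :: "('e \<times> bool) set set"
  assumes rs: "rotation_system E \<sigma>"
    and conn: "connected_nodes E \<sigma> (nodes E \<sigma>)"
    and genus: "has_genus E \<sigma> g"
    and circ: "smooth_circulation E \<sigma> h"
    and nonzero: "\<exists>e\<in>E. h e \<noteq> 0"
    and U: "connected_nodes E \<sigma> U"
    and vanish: "\<forall>e\<in>E. (tl_node \<sigma> e \<in> U \<or> hd_node \<sigma> e \<in> U) \<longrightarrow> h e = 0"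
  shows "\<exists>X \<subseteq> nodes E \<sigma>. card X \<le> 16 * g \<and>
           (\<forall>p. is_path E \<sigma> p \<and> hd p \<in> U \<and> last p \<in> support_nodes E \<sigma> h
                \<longrightarrow> set p \<inter> X \<noteq> {})"
proof -
  define D where "D = darts E"
  define H where "H d = (if snd d then h (fst d) else - h (fst d))" for d :: "'e \<times> bool"
  interpret weighted_darts rev_dart H
    by unfold_locales (auto simp: rev_dart_def H_def prod_eq_iff)
  have finE: "finite E" and bij: "bij_betw \<sigma> D D"
    using rs by (auto simp: rotation_system_def D_def)
  have fin: "finite D" using finE by (simp add: D_def darts_def)
  have rvD: "rev_dart ` D \<subseteq> D" by (auto simp: D_def darts_def rev_dart_def)
  have bp: "bij_betw (\<sigma> \<circ> rev_dart) D D" by (rule bij_betw_comp_rv[OF bij rvD])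
  have nodes: "nodes E \<sigma> = orbs \<sigma> D" and faces: "faces E \<sigma> = orbs (\<sigma> \<circ> rev_dart) D"
    by (simp_all add: nodes_def faces_def orbs_def D_def)
  have HTF: "H (e, True) = h e" "H (e, False) = - h e" for e by (simp_all add: H_def)
  have "sum H v = 0" if v: "v \<in> orbs \<sigma> D" for v
  proof -
    have "v \<subseteq> darts E" using v Union_orbs[OF bij] by (auto simp: D_def)
    \<comment> \<open>The minus sign arises because \<open>(e, True)\<close> is the dart at the
      tail, where \<open>delta_node\<close> contributes -1.\<close>
    then have "sum H v = - (\<Sum>e\<in>E. h e * delta_node \<sigma> v e)"
      unfolding sum_darts[OF finE \<open>v \<subseteq> darts E\<close> HTF] sum_negf[symmetric]
      by (intro sum.cong)
        (auto simp: delta_node_def hd_node_def tl_node_def orb_eq_iff[OF fin bij v])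
    then show ?thesis using circ v by (simp add: smooth_circulation_def nodes)
  qed
  then have bal_nodes: "balanced H \<sigma> D = nodes E \<sigma>" by (auto simp: balanced_def nodes)
  have "sum H F = 0" if F: "F \<in> orbs (\<sigma> \<circ> rev_dart) D" for F
  proof -
    have "F \<subseteq> darts E" using F Union_orbs[OF bp] by (auto simp: D_def)
    then have "sum H F = (\<Sum>e\<in>E. h e * bd_face \<sigma> F e)"
      unfolding sum_darts[OF finE \<open>F \<subseteq> darts E\<close> HTF]
      by (intro sum.cong)
        (auto simp: bd_face_def rshore_def lshore_def orb_eq_iff[OF fin bp F])
    then show ?thesis using circ F by (simp add: smooth_circulation_def faces)
  qed
  then have bal_faces: "balanced H (\<sigma> \<circ> rev_dart) D = faces E \<sigma>"
    by (auto simp: balanced_def faces)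
  have cardD: "card D = 2 * card E" by (simp add: D_def darts_def card_cartesian_product)

  have node: "orb \<sigma> x = v" if "v \<in> nodes E \<sigma>" "x \<in> v" for x v
    using that orb_eq_iff[OF fin bij] by (auto simp: nodes)
  have orb_node: "orb \<sigma> x \<in> nodes E \<sigma>" if "x \<in> D" for x using that by (auto simp: nodes orbs_def)
  have node_sub: "v \<subseteq> D" if "v \<in> nodes E \<sigma>" for v using that Union_orbs[OF bij] by (auto simp: nodes)
  have supp: "v \<in> support_nodes E \<sigma> h \<longleftrightarrow> (\<exists>x\<in>v. H x \<noteq> 0)" if v: "v \<in> nodes E \<sigma>" for v
  proof
    assume "v \<in> support_nodes E \<sigma> h"
    then obtain e where "h e \<noteq> 0" "v = orb \<sigma> (e, True) \<or> v = orb \<sigma> (e, False)"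
      by (auto simp: support_nodes_def tl_node_def hd_node_def)
    then show "\<exists>x\<in>v. H x \<noteq> 0"
      using orb_self[of "(e, True)" \<sigma>] orb_self[of "(e, False)" \<sigma>] HTF[of e] by force
  next
    assume "\<exists>x\<in>v. H x \<noteq> 0"
    then obtain e b where x: "(e, b) \<in> v" "h e \<noteq> 0" by (auto simp: H_def split: if_splits)
    then have "orb \<sigma> (e, b) = v" "e \<in> E"
      using node[OF v] node_sub[OF v] by (auto simp: D_def darts_def)
    then show "v \<in> support_nodes E \<sigma> h"
      using x by (cases b) (auto simp: support_nodes_def tl_node_def hd_node_def)
  qed
  define Z where "Z = nodes E \<sigma> - support_nodes E \<sigma> h"
  define R where "R = {(u, v). adjacent E \<sigma> u v \<and> u \<in> Z \<and> v \<in> Z}"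
  have UN: "U \<subseteq> nodes E \<sigma>" and "U \<noteq> {}" using U by (auto simp: connected_nodes_def)
  then obtain u0 where u0: "u0 \<in> U" by blast
  have UZ: "U \<subseteq> Z"
  proof
    fix u assume u: "u \<in> U"
    have "u \<notin> support_nodes E \<sigma> h"
      using vanish u by (auto simp: support_nodes_def)
    then show "u \<in> Z" using u UN by (auto simp: Z_def)
  qed
  \<comment> \<open>\<open>U\<close> is enlarged to its component among the zero nodes: a neighbour
    of \<open>W\<close> outside \<open>W\<close> then always lies in the support, and
    \<open>Y\<close> below collects these neighbours.\<close>
  define W where "W = R\<^sup>* `` {u0}"
  have WZ: "W \<subseteq> Z"
  proof
    fix w assume "w \<in> W"
    then have "(u0, w) \<in> R\<^sup>*" by (simp add: W_def)
    then show "w \<in> Z" by cases (use u0 UZ in \<open>auto simp: R_def\<close>)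
  qed
  have Wstep: "v \<in> W" if "w \<in> W" "adjacent E \<sigma> w v" "v \<in> Z" for v w
  proof -
    have "(w, v) \<in> R" using that WZ by (auto simp: R_def)
    then show ?thesis using that(1) rtrancl_into_rtrancl[of u0 w R v] by (simp add: W_def)
  qed
  have UW: "U \<subseteq> W"
  proof
    fix u assume u: "u \<in> U"
    have "\<forall>u\<in>U. \<forall>w\<in>U. \<exists>p. is_path E \<sigma> p \<and> hd p = u \<and> last p = w \<and> set p \<subseteq> U"
      using U by (simp add: connected_nodes_def)
    from bspec[OF bspec[OF this u0] u]
    obtain p where p: "is_path E \<sigma> p" "hd p = u0" "last p = u" "set p \<subseteq> U" by blast
    have "last p \<in> W \<or> set p \<inter> {} \<noteq> {}"
    proof (rule is_path_invariant[where N = U, OF _ p(1,4)])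
      show "w \<in> W \<or> w \<in> {}" if "v \<in> W" "adjacent E \<sigma> v w" "w \<in> U" for v w
        using Wstep[OF that(1,2)] that(3) UZ by blast
      show "hd p \<in> W" by (simp add: W_def p(2))
    qed
    then show "u \<in> W" using p(3) by simp
  qed
  define Y where "Y = {y \<in> nodes E \<sigma> \<inter> support_nodes E \<sigma> h. \<exists>w\<in>W. adjacent E \<sigma> w y}"
  have hits: "set p \<inter> Y \<noteq> {}"
    if p: "is_path E \<sigma> p" "hd p \<in> U" "last p \<in> support_nodes E \<sigma> h" for p
  proof -
    have "last p \<in> W \<or> set p \<inter> Y \<noteq> {}"
    proof (rule is_path_invariant[where N = "nodes E \<sigma>", OF _ p(1)])
      show "v \<in> W \<or> v \<in> Y" if "u \<in> W" "adjacent E \<sigma> u v" "v \<in> nodes E \<sigma>" for u v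
      proof (cases "v \<in> Z")
        case True
        then show ?thesis using Wstep[OF that(1,2)] by blast
      next
        case False
        then show ?thesis using that by (auto simp: Y_def Z_def)
      qed
    qed (use p UW in \<open>auto simp: is_path_def\<close>)
    then show ?thesis using p(3) WZ by (auto simp: Z_def)
  qed

  define Om where "Om = \<Union>W"
  have WN: "W \<subseteq> nodes E \<sigma>" using WZ by (auto simp: Z_def)
  have OmW: "x \<in> Om \<longleftrightarrow> x \<in> D \<and> orb \<sigma> x \<in> W" for x
    using node WN node_sub orb_self[of x \<sigma>] unfolding Om_def by blast
  have adj: "adjacent E \<sigma> (orb \<sigma> x) (orb \<sigma> (rev_dart x))" if "x \<in> D" for x
    using that by (auto simp: adjacent_iff_dart D_def)
  have bdry: "orb \<sigma> (rev_dart x) \<in> support_nodes E \<sigma> h" if "x \<in> Om" "rev_dart x \<notin> Om" for x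
  proof -
    have x: "x \<in> D" "orb \<sigma> x \<in> W" "rev_dart x \<in> D" using that OmW rvD by auto
    then show ?thesis using Wstep[OF x(2) adj[OF x(1)]] orb_node[OF x(3)] that OmW by (auto simp: Z_def)
  qed
  have "\<exists>d. d \<in> Om \<and> orb \<sigma> (rev_dart d) = y" if y: "y \<in> Y" for y
  proof -
    obtain w where w: "w \<in> W" "adjacent E \<sigma> w y" using y unfolding Y_def by blast
    then obtain d where "d \<in> D" "orb \<sigma> d = w" "orb \<sigma> (rev_dart d) = y"
      unfolding adjacent_iff_dart D_def by blast
    then show ?thesis using w OmW by blast
  qed
  \<comment> \<open>One dart leading from \<open>W\<close> to each node of \<open>Y\<close>: these
    become the spokes.\<close>
  then obtain k where k: "\<And>y. y \<in> Y \<Longrightarrow> k y \<in> Om" "\<And>y. y \<in> Y \<Longrightarrow> orb \<sigma> (rev_dart (k y)) = y"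
    by metis
  have "inj_on k Y" using k(2) by (metis inj_onI)
  then have cardK: "card (k ` Y) = card Y" by (rule card_image)
  have "card Y \<le> 16 * g"
  \<comment> \<open>The counting bound requires a spoke. For genus 0 it is contradictory, so there
    \<open>Y\<close> is empty.\<close>
  proof (cases "Y = {}")
    case False
    have "card (k ` Y) + 2 * card (balanced H \<sigma> D) + 2 * card (balanced H (\<sigma> \<circ> rev_dart) D)
        \<le> card D + 3"
    proof (rule contraction_bound[OF fin bij rvD, where \<Omega> = Om])
      show "Om \<subseteq> D" using OmW by blast
      show "\<sigma> ` Om \<subseteq> Om"
      proof
        fix z assume "z \<in> \<sigma> ` Om"
        then obtain x w where "x \<in> w" "w \<in> W" "z = \<sigma> x" by (auto simp: Om_def)
        then have "z \<in> w" using node[of w x] WN orb_step[OF orb_self, of \<sigma> x] by blast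
        then show "z \<in> Om" using \<open>w \<in> W\<close> by (auto simp: Om_def)
      qed
      show "H x = 0" if "x \<in> Om" for x
        using that WZ supp by (auto simp: Om_def Z_def)
      show "k ` Y \<subseteq> Om" "k ` Y \<noteq> {}" using k False by auto
      show "rev_dart x \<notin> Om" if "x \<in> k ` Y" for x
      proof
        assume "rev_dart x \<in> Om"
        then have "orb \<sigma> (rev_dart x) \<in> Z" using OmW WZ by blast
        moreover have "orb \<sigma> (rev_dart x) \<in> Y" using that k(2) by auto
        ultimately show False by (simp add: Y_def Z_def)
      qed
      show "\<exists>y\<in>orb \<sigma> (rev_dart x). H y \<noteq> 0" if x: "x \<in> Om" "rev_dart x \<notin> Om" for x
      proof -
        have "rev_dart x \<in> D" using x OmW rvD by auto
        then show ?thesis using supp[OF orb_node] bdry[OF x] by blast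
      qed
      show "x = y" if "x \<in> k ` Y" "y \<in> k ` Y" "orb \<sigma> (rev_dart x) = orb \<sigma> (rev_dart y)" for x y
        using that k(2) by auto
      have sat: "orb \<sigma> t \<subseteq> T" if "\<sigma> ` T \<subseteq> T" "t \<in> T" for T t
        using that by (intro orb_least) auto
      show "T = Om"
        if T: "T \<subseteq> Om" "T \<noteq> {}" "\<sigma> ` T \<subseteq> T"
          and Trv: "\<And>x. x \<in> T \<Longrightarrow> rev_dart x \<in> Om \<Longrightarrow> rev_dart x \<in> T" for T
      proof -
        obtain t where t: "t \<in> T" using T(2) by blast
        have "orb \<sigma> t \<in> W" using t T(1) OmW by blast
        then have "(u0, orb \<sigma> t) \<in> R\<^sup>*" by (simp add: W_def)
        \<comment> \<open>By symmetry of adjacency, \<open>T\<close> can be followed from any of its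
          nodes back to \<open>u0\<close> and from there to all of \<open>W\<close>.\<close>
        moreover have "sym R" by (auto simp: R_def adjacent_def sym_def)
        ultimately have to_u0: "(orb \<sigma> t, u0) \<in> R\<^sup>*" using sym_rtrancl by (metis symD)
        have "v \<subseteq> T \<and> v \<in> W" if "(orb \<sigma> t, v) \<in> R\<^sup>*" for v
          using that
        proof (induction rule: rtrancl_induct)
          case base
          show ?case using sat[OF T(3) t] t T(1) OmW by blast
        next
          case (step v w)
          have vw: "adjacent E \<sigma> v w" "w \<in> Z" using step by (auto simp: R_def)
          then have wW: "w \<in> W" using Wstep step by blast
          obtain d where d: "d \<in> D" "orb \<sigma> d = v" "orb \<sigma> (rev_dart d) = w"
            using vw(1) by (auto simp: adjacent_iff_dart D_def)
          have "d \<in> T" using d(2) orb_self[of d \<sigma>] step by blast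
          moreover have "rev_dart d \<in> Om" using d wW rvD OmW by auto
          ultimately have "rev_dart d \<in> T" by (rule Trv)
          then show ?case using sat[OF T(3)] d(3) wW by blast
        qed
        then have "w \<subseteq> T" if "w \<in> W" for w
          using that to_u0 rtrancl_trans[of "orb \<sigma> t" u0 R w] by (auto simp: W_def)
        then show ?thesis using T(1) by (auto simp: Om_def)
      qed
      \<comment> \<open>Connectedness of the whole graph enters here: a set closed under rotation
        and reversal spreads along a path to an edge with non-zero \<open>h\<close>.\<close>
      show "\<exists>x\<in>T. H x \<noteq> 0"
        if T: "T \<subseteq> D" "T \<noteq> {}" "\<sigma> ` T \<subseteq> T" "rev_dart ` T \<subseteq> T" for T
      proof -
        obtain t where t: "t \<in> T" using T(2) by blast
        obtain e where e: "e \<in> E" "h e \<noteq> 0" using nonzero by blast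
        then have eD: "(e, True) \<in> D" by (simp add: D_def darts_def)
        have "\<forall>u\<in>nodes E \<sigma>. \<forall>w\<in>nodes E \<sigma>. \<exists>p. is_path E \<sigma> p \<and> hd p = u \<and> last p = w"
          using conn unfolding connected_nodes_def by meson
        moreover have "orb \<sigma> t \<in> nodes E \<sigma>" using orb_node t T(1) by blast
        ultimately obtain p where p: "is_path E \<sigma> p" "hd p = orb \<sigma> t" "last p = orb \<sigma> (e, True)"
          using orb_node[OF eD] by metis
        have pN: "set p \<subseteq> nodes E \<sigma>" using p(1) by (simp add: is_path_def)
        have "last p \<in> {v. v \<subseteq> T} \<or> set p \<inter> {} \<noteq> {}"
        proof (rule is_path_invariant[where N = "nodes E \<sigma>", OF _ p(1) pN])
          fix u v assume "u \<in> {v. v \<subseteq> T}" "adjacent E \<sigma> u v"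
          then obtain d where d: "orb \<sigma> d \<subseteq> T" "v = orb \<sigma> (rev_dart d)"
            by (auto simp: adjacent_iff_dart)
          then have "rev_dart d \<in> T" using orb_self[of d \<sigma>] T(4) by blast
          then show "v \<in> {v. v \<subseteq> T} \<or> v \<in> {}" using sat[OF T(3)] d(2) by blast
        qed (use p(2) sat[OF T(3) t] in simp)
        then have "(e, True) \<in> T" using p(3) orb_self[of "(e, True)" \<sigma>] by auto
        then show ?thesis using e(2) HTF(1)[of e] by (intro bexI[of _ "(e, True)"]) simp
      qed
    qed
    \<comment> \<open>Initially every orbit is balanced, so the inequality reads card Y + 2(V + F)
      \<le> 2|E| + 3; with V + F = |E| + 2 - 2g this is card Y \<le> 4g - 1.\<close>
    then show ?thesis
      using genus unfolding has_genus_def bal_nodes bal_faces cardD cardK by linarith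
  qed simp
  moreover have "Y \<subseteq> nodes E \<sigma>" by (auto simp: Y_def)
  ultimately show ?thesis using hits by blast
qed

end
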